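(* Let $\mathbf{R}$ be a finite-dimensional associative unital algebra over a field $\mathbf{K}$, let $R\in\mathbf{R}^{\otimes2}$ be an invertible solution of the quantum Yang–Baxter equation $R_{12}R_{13}R_{23}=R_{23}R_{13}R_{12}$, and let $\mathcal{U}\subset T(\mathbf{R})$ be the subbialgebra determined by $R$. Let $\Phi^{1,1}\in\mathbf{R}^{\otimes2}$ be invertible, denote by $\Phi_{ij}$ its images under the embeddings of $\mathbf{R}^{\otimes 2}$ into tensor powers of $\mathbf{R}$ in places $i,j$, and set $\tilde R=(\Phi_{21})^{-1}R\,\Phi_{12}\in\mathbf{R}^{\otimes2}$. Suppose that in $\mathbf{R}^{\otimes3}$ $$R_{23}\Phi_{12}\Phi_{13}=\Phi_{13}\Phi_{12}R_{23},\qquad \tilde R_{12}\Phi_{13}\Phi_{23}=\Phi_{23}\Phi_{13}\tilde R_{12}.$$ Then the unique invertible normalized solution $\Phi\in T(\mathbf{R})\otimes T(\mathbf{R})$ of the twisting equation $(\Delta\otimes \mathrm{id})(\Phi)\Phi_{12}=(\mathrm{id}\otimes\Delta)(\Phi)\Phi_{23}$ with $$(\pi^1\otimes\pi^k)(\Phi)=\Phi_{12}\Phi_{13}\cdots\Phi_{1\,(k+1)}\in\mathbf{R}\otimes\mathbf{R}^{\otimes k},\qquad k\ge1$$ (the factors on the right being images of $\Phi^{1,1}$), belongs to $\mathcal{U}\otimes\mathcal{U}$; that is, $(\pi^m\otimes\pi^n)(\Phi)\in\pi^m(\mathcal{U})\otimes\pi^n(\mathcal{U})$ for all $m,n\ge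0$.
   Context: The tensor bialgebra: $T(\mathbf{R})=\prod_{n\ge 0}\mathbf{R}^{\otimes n}$ with $\mathbf{R}^{\otimes 0}=\mathbf{K}$. The multiplication is componentwise (each $\mathbf{R}^{\otimes n}$ has its tensor-product algebra structure with unit $e^n$, and $\mathbf{R}^{\otimes n}\mathbf{R}^{\otimes m}=0$ for $n\neq m$), and the unit is $1=\sum_n e^n$. $\pi^n\colon T(\mathbf{R})\to\mathbf{R}^{\otimes n}$ are the projections and $\varepsilon=\pi^0$ is the counit. The coproduct is $\Delta(y_1\otimes\cdots\otimes y_n)=\sum_{k=0}^{n}(y_1\otimes\cdots\otimes y_k)\otimes(y_{k+1}\otimes\cdots\otimes y_n)$ for $y_i\in\mathbf{R}$ (empty products are $e^0$). Tensor products of $T(\mathbf{R})$ are completed: $T(\mathbf{R})\otimes T(\mathbf{R})=\prod_{m,n}\mathbf{R}^{\otimes m}\otimes\mathbf{R}^{\otimes n}$, etc. In the twisting equation, $\Phi_{12}=\Phi\otimes 1$ and $\Phi_{23}=1\otimes\Phi$ in $T(\mathbf{R})^{\otimes3}$. Normalized means $(\varepsilon\otimes\mathrm{id})(\Phi)=(\mathrm{id}\otimes\varepsilon)(\Phi)=1$. For every family of invertible elements $\Phi^{1,k}\in\mathbf{R}\otimes\mathbf{R}^{\otimes k}$, $k\ge1$, there is a unique invertible normalized solution $\Phi$ of the twisting equation with $(\pi^1\otimes\pi^k)(\Phi)=\Phi^{1,k}$. The subbialgebra $\mathcal{U}$ determined by $R$: let $\tau$ be the flip on $\mathbf{R}^{\otimes2}$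 and $\mathbf{S}=\{z\in\mathbf{R}^{\otimes2}: RzR^{-1}=\tau(z)\}$. Then $\mathcal{U}=\prod_{n\ge0}\pi^n(\mathcal{U})$, where $\pi^0(\mathcal{U})=\mathbf{K}$, $\pi^1(\mathcal{U})=\mathbf{R}$, $\pi^2(\mathcal{U})=\mathbf{S}$, and for $n\ge2$ $\pi^n(\mathcal{U})=\bigcap_{i+j+2=n}\mathbf{R}^{\otimes i}\otimes\mathbf{S}\otimes\mathbf{R}^{\otimes j}$. *)

theory Defs
  imports Complex_Main
begin

section \<open>Finite-dimensional algebras and their tensor powers\<close>

text \<open>
  The algebra is the whole type 'a; its sort does not force 0 and 1 to differ.  The record
  carries the scalar action and a finite basis B, which only serves to construct tensor powers:
  the tensors b1 ... bn of elements of B form a basis of the n-th tensor power, so an element of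
  that power is given by its coefficient function on the words b1 ... bn of length n over B
  (and is 0 on all other lists).  The basis is arbitrary, and by the lemmas on pure tensors
  below the operations are given by the usual basis-free formulas.
\<close>

record ('k, 'a) based_algebra =
  scale :: "'k \<Rightarrow> 'a \<Rightarrow> 'a"
  basis :: "'a set"

locale fd_algebra =
  finite_dimensional_vector_space "scale A" "basis A"
  for A :: "('k::field, 'a::{ring,monoid_mult}) based_algebra" (structure) +
  assumes scale_mult_left: "scale A c x * y = scale A c (x * y)"
    and scale_mult_right: "x * scale A c y = scale A c (x * y)"

type_synonym ('k, 'a) tensor = "'a list \<Rightarrow> 'k"

definition coord :: "('k::field, 'a::{ring,monoid_mult}) based_algebra \<Rightarrow> 'a \<Rightarrow> 'a \<Rightarrow> 'k"
  where "coord A x b = module.representation (scale A) (basis A) x b"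

definition words :: "('k::field, 'a::{ring,monoid_mult}) based_algebra \<Rightarrow> nat \<Rightarrow> 'a list set"
  where "words A n = {u. set u \<subseteq> basis A \<and> length u = n}"

definition tpow :: "('k::field, 'a::{ring,monoid_mult}) based_algebra \<Rightarrow> nat \<Rightarrow> ('k, 'a) tensor set"
  where "tpow A n = {x. \<forall>u. u \<notin> words A n \<longrightarrow> x u = 0}"

text \<open>The pure tensor of the entries of a list of algebra elements.\<close>

definition pure_tensor ::
    "('k::field, 'a::{ring,monoid_mult}) based_algebra \<Rightarrow> 'a list \<Rightarrow> ('k, 'a) tensor"
  where "pure_tensor A ys u =
    (if length u = length ys then \<Prod>l<length ys. coord A (ys ! l) (u ! l) else 0)"

text \<open>Bilinear extension of the product of basis tensors.\<close>

definition tmult ::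
    "('k::field, 'a::{ring,monoid_mult}) based_algebra \<Rightarrow>
      ('k, 'a) tensor \<Rightarrow> ('k, 'a) tensor \<Rightarrow> ('k, 'a) tensor"
    (infixl "\<odot>\<index>" 70)
  where "x \<odot>\<^bsub>A\<^esub> y = (\<lambda>u. \<Sum>v\<in>words A (length u). \<Sum>w\<in>words A (length u).
    x v * y w * pure_tensor A (map2 (*) v w) u)"

definition tone :: "('k::field, 'a::{ring,monoid_mult}) based_algebra \<Rightarrow> nat \<Rightarrow> ('k, 'a) tensor"
  where "tone A n = pure_tensor A (replicate n 1)"

definition tinvertible ::
    "('k::field, 'a::{ring,monoid_mult}) based_algebra \<Rightarrow> nat \<Rightarrow> ('k, 'a) tensor \<Rightarrow> bool"
  where "tinvertible A n x \<longleftrightarrow>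
    x \<in> tpow A n \<and> (\<exists>y\<in>tpow A n. x \<odot>\<^bsub>A\<^esub> y = tone A n \<and> y \<odot>\<^bsub>A\<^esub> x = tone A n)"

definition tinv ::
    "('k::field, 'a::{ring,monoid_mult}) based_algebra \<Rightarrow> nat \<Rightarrow> ('k, 'a) tensor \<Rightarrow> ('k, 'a) tensor"
  where "tinv A n x =
    (THE y. y \<in> tpow A n \<and> x \<odot>\<^bsub>A\<^esub> y = tone A n \<and> y \<odot>\<^bsub>A\<^esub> x = tone A n)"

text \<open>
  \<open>place A n i j\<close> embeds the tensor square into the n-th tensor power, with the first tensor
  factor at place i and the second one at place j (i and j distinct, in 1, ..., n).
\<close>

definition place ::
    "('k::field, 'a::{ring,monoid_mult}) based_algebra \<Rightarrow> nat \<Rightarrow> nat \<Rightarrow> nat \<Rightarrow>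
      ('k, 'a) tensor \<Rightarrow> ('k, 'a) tensor"
  where "place A n i j x = (\<lambda>u.
    if length u = n
    then x [u ! (i - 1), u ! (j - 1)] * (\<Prod>l\<in>{..<n} - {i - 1, j - 1}. coord A 1 (u ! l))
    else 0)"

text \<open>The flip of the tensor square: two-letter words are reversed.\<close>

definition flip :: "('k, 'a) tensor \<Rightarrow> ('k, 'a) tensor"
  where "flip x = (\<lambda>u. x (rev u))"

text \<open>
  Outer tensor product; on homogeneous elements of degrees m and n only the summand k = m
  contributes.  It identifies the tensor product of the m-th and the n-th tensor power with
  the (m+n)-th one.
\<close>

definition ttimes :: "('k::field, 'a) tensor \<Rightarrow> ('k, 'a) tensor \<Rightarrow> ('k, 'a) tensor"
    (infixr "\<otimes>" 75)
  where "x \<otimes> y = (\<lambda>u. \<Sum>k\<le>length u. x (take k u) * y (drop k u))"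

text \<open>The tensor product of two subspaces, as the set of finite sums of elementary tensors.\<close>

definition subspace_tensor ::
    "('k::field, 'a) tensor set \<Rightarrow> ('k, 'a) tensor set \<Rightarrow> ('k, 'a) tensor set"
    (infixr "\<otimes>\<^sub>s" 75)
  where "V \<otimes>\<^sub>s W = {z. \<exists>(r::nat) x y. (\<forall>i<r. x i \<in> V \<and> y i \<in> W) \<and>
    z = (\<lambda>u. \<Sum>i<r. (x i \<otimes> y i) u)}"

section \<open>The tensor bialgebra and the twisting equation\<close>

text \<open>
  Elements of the completed tensor bialgebra T, of its tensor square and of its tensor cube
  are families of homogeneous components; the component of multidegree (m, n), say, lies in
  \<open>tpow A (m + n)\<close>.
\<close>

type_synonym ('k, 'a) T1 = "nat \<Rightarrow> ('k, 'a) tensor"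
type_synonym ('k, 'a) T2 = "nat \<Rightarrow> nat \<Rightarrow> ('k, 'a) tensor"
type_synonym ('k, 'a) T3 = "nat \<Rightarrow> nat \<Rightarrow> nat \<Rightarrow> ('k, 'a) tensor"

definition T1_space :: "('k::field, 'a::{ring,monoid_mult}) based_algebra \<Rightarrow> ('k, 'a) T1 set"
  where "T1_space A = {x. \<forall>n. x n \<in> tpow A n}"

definition T2_space :: "('k::field, 'a::{ring,monoid_mult}) based_algebra \<Rightarrow> ('k, 'a) T2 set"
  where "T2_space A = {\<Phi>. \<forall>m n. \<Phi> m n \<in> tpow A (m + n)}"

definition T1_one :: "('k::field, 'a::{ring,monoid_mult}) based_algebra \<Rightarrow> ('k, 'a) T1"
  where "T1_one A = (\<lambda>n. tone A n)"

definition T2_one :: "('k::field, 'a::{ring,monoid_mult}) based_algebra \<Rightarrow> ('k, 'a) T2"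
  where "T2_one A = (\<lambda>m n. T1_one A m \<otimes> T1_one A n)"

definition T2_mult ::
    "('k::field, 'a::{ring,monoid_mult}) based_algebra \<Rightarrow> ('k, 'a) T2 \<Rightarrow> ('k, 'a) T2 \<Rightarrow> ('k, 'a) T2"
  where "T2_mult A \<Phi> \<Psi> = (\<lambda>m n. \<Phi> m n \<odot>\<^bsub>A\<^esub> \<Psi> m n)"

definition T3_mult ::
    "('k::field, 'a::{ring,monoid_mult}) based_algebra \<Rightarrow> ('k, 'a) T3 \<Rightarrow> ('k, 'a) T3 \<Rightarrow> ('k, 'a) T3"
  where "T3_mult A X Y = (\<lambda>i j k. X i j k \<odot>\<^bsub>A\<^esub> Y i j k)"

definition T2_invertible ::
    "('k::field, 'a::{ring,monoid_mult}) based_algebra \<Rightarrow> ('k, 'a) T2 \<Rightarrow> bool"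
  where "T2_invertible A \<Phi> \<longleftrightarrow> \<Phi> \<in> T2_space A \<and>
    (\<exists>\<Psi>\<in>T2_space A. T2_mult A \<Phi> \<Psi> = T2_one A \<and> T2_mult A \<Psi> \<Phi> = T2_one A)"

definition counit :: "('k, 'a) T1 \<Rightarrow> 'k"
  where "counit x = x 0 []"

text \<open>
  Deconcatenation: in bidegree (i, j) the coproduct splits the first i tensor factors of the
  component of degree i + j from the remaining j ones; see \<open>coproduct_pure_tensor\<close> below.
\<close>

definition coproduct :: "('k, 'a) T1 \<Rightarrow> ('k, 'a) T2"
  where "coproduct x = (\<lambda>i j. x (i + j))"

text \<open>
  The tensor products of the counit and of the coproduct with the identity.  Fixing the word
  in the tensor factor on which the identity acts turns an element of the tensor square into
  an element of T, to which the map is applied.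
\<close>

definition counit_left :: "('k, 'a) T2 \<Rightarrow> ('k, 'a) T1"
  where "counit_left \<Phi> = (\<lambda>n w. counit (\<lambda>m u. \<Phi> m n (u @ w)))"

definition counit_right :: "('k, 'a) T2 \<Rightarrow> ('k, 'a) T1"
  where "counit_right \<Phi> = (\<lambda>m u. counit (\<lambda>n w. \<Phi> m n (u @ w)))"

definition coproduct_left :: "('k, 'a) T2 \<Rightarrow> ('k, 'a) T3"
  where "coproduct_left \<Phi> = (\<lambda>i j k t.
    coproduct (\<lambda>m u. \<Phi> m k (u @ drop (i + j) t)) i j (take (i + j) t))"

definition coproduct_right :: "('k, 'a) T2 \<Rightarrow> ('k, 'a) T3"
  where "coproduct_right \<Phi> = (\<lambda>i j k t.
    coproduct (\<lambda>n w. \<Phi> i n (take i t @ w)) j k (drop i t))"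

definition T3_12 :: "('k::field, 'a::{ring,monoid_mult}) based_algebra \<Rightarrow> ('k, 'a) T2 \<Rightarrow> ('k, 'a) T3"
  where "T3_12 A \<Phi> = (\<lambda>i j k. \<Phi> i j \<otimes> T1_one A k)"

definition T3_23 :: "('k::field, 'a::{ring,monoid_mult}) based_algebra \<Rightarrow> ('k, 'a) T2 \<Rightarrow> ('k, 'a) T3"
  where "T3_23 A \<Phi> = (\<lambda>i j k. T1_one A i \<otimes> \<Phi> j k)"

definition normalized :: "('k::field, 'a::{ring,monoid_mult}) based_algebra \<Rightarrow> ('k, 'a) T2 \<Rightarrow> bool"
  where "normalized A \<Phi> \<longleftrightarrow> counit_left \<Phi> = T1_one A \<and> counit_right \<Phi> = T1_one A"

definition twisting_equation ::
    "('k::field, 'a::{ring,monoid_mult}) based_algebra \<Rightarrow> ('k, 'a) T2 \<Rightarrow> bool"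
  where "twisting_equation A \<Phi> \<longleftrightarrow>
    T3_mult A (coproduct_left \<Phi>) (T3_12 A \<Phi>) = T3_mult A (coproduct_right \<Phi>) (T3_23 A \<Phi>)"

text \<open>Invertible normalized solutions whose component of bidegree (1, k) is \<open>F k\<close> for k > 0.\<close>

definition twist_with_components ::
    "('k::field, 'a::{ring,monoid_mult}) based_algebra \<Rightarrow> (nat \<Rightarrow> ('k, 'a) tensor) \<Rightarrow>
      ('k, 'a) T2 \<Rightarrow> bool"
  where "twist_with_components A F \<Phi> \<longleftrightarrow>
    T2_invertible A \<Phi> \<and> normalized A \<Phi> \<and> twisting_equation A \<Phi> \<and> (\<forall>k\<ge>1. \<Phi> 1 k = F k)"

section \<open>The subbialgebra determined by an R-matrix\<close>

definition flip_subspace ::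
    "('k::field, 'a::{ring,monoid_mult}) based_algebra \<Rightarrow> ('k, 'a) tensor \<Rightarrow> ('k, 'a) tensor set"
  where "flip_subspace A R = {z \<in> tpow A 2. R \<odot>\<^bsub>A\<^esub> z \<odot>\<^bsub>A\<^esub> tinv A 2 R = flip z}"

definition sub_component ::
    "('k::field, 'a::{ring,monoid_mult}) based_algebra \<Rightarrow> ('k, 'a) tensor \<Rightarrow> nat \<Rightarrow>
      ('k, 'a) tensor set"
  where "sub_component A R n =
    (if n < 2 then tpow A n
     else \<Inter>{tpow A i \<otimes>\<^sub>s flip_subspace A R \<otimes>\<^sub>s tpow A j | i j. i + j + 2 = n})"

text \<open>The completed tensor square of the subbialgebra.\<close>

definition sub_square ::
    "('k::field, 'a::{ring,monoid_mult}) based_algebra \<Rightarrow> ('k, 'a) tensor \<Rightarrow> ('k, 'a) T2 set"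
  where "sub_square A R =
    {\<Phi>. \<forall>m n. \<Phi> m n \<in> sub_component A R m \<otimes>\<^sub>s sub_component A R n}"

section \<open>The operations on pure tensors\<close>

context fd_algebra
begin

lemma coord_add: "coord A (x + y) b = coord A x b + coord A y b"
  unfolding coord_def
  by (simp add: representation_add independent_Basis span_Basis)

lemma coord_scale: "coord A (scale A c x) b = c * coord A x b"
  unfolding coord_def
  by (simp add: representation_scale independent_Basis span_Basis)

lemma coord_sum: "coord A (sum f I) b = (\<Sum>i\<in>I. coord A (f i) b)"
  unfolding coord_def
  by (simp add: representation_sum independent_Basis span_Basis)

lemma coord_basis: "b \<in> basis A \<Longrightarrow> coord A b = (\<lambda>c. if c = b then 1 else 0)"
  unfolding coord_def by (simp add: representation_basis independent_Basis)

lemma coord_outside: "b \<notin> basis A \<Longrightarrow> coord A x b = 0"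
  unfolding coord_def using representation_ne_zero by blast

lemma coord_expand: "(\<Sum>b\<in>basis A. scale A (coord A x b) b) = x"
  unfolding coord_def
  using sum_representation_eq[of "basis A" x "basis A"]
  by (simp add: independent_Basis span_Basis finite_Basis)

lemma coord_mult:
  "coord A (x * y) b =
    (\<Sum>p\<in>basis A. \<Sum>q\<in>basis A. coord A x p * coord A y q * coord A (p * q) b)"
proof -
  have "x * y = (\<Sum>p\<in>basis A. scale A (coord A x p) p) * (\<Sum>q\<in>basis A. scale A (coord A y q) q)"
    by (simp add: coord_expand)
  also have "\<dots> = (\<Sum>p\<in>basis A. \<Sum>q\<in>basis A.
      scale A (coord A x p) (scale A (coord A y q) (p * q)))"
    by (simp add: sum_product scale_mult_left scale_mult_right mult.commute)
  finally show ?thesis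
    by (simp add: coord_sum coord_scale mult.assoc)
qed

lemma words_0: "words A 0 = {[]}"
  by (auto simp: words_def)

lemma finite_words: "finite (words A n)"
  unfolding words_def by (rule finite_lists_length_eq[OF finite_Basis])

lemma sum_words_Suc: "(\<Sum>u\<in>words A (Suc n). f u) = (\<Sum>b\<in>basis A. \<Sum>u\<in>words A n. f (b # u))"
proof -
  have eq: "words A (Suc n) = (\<lambda>(b, u). b # u) ` (basis A \<times> words A n)"
    by (auto simp: words_def image_def length_Suc_conv)
  have "inj_on (\<lambda>(b, u). b # u) (basis A \<times> words A n)"
    by (auto simp: inj_on_def)
  then have "(\<Sum>u\<in>words A (Suc n). f u) = (\<Sum>p\<in>basis A \<times> words A n. f (fst p # snd p))"
    unfolding eq by (subst sum.reindex) (auto simp: case_prod_unfold)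
  then show ?thesis
    by (simp add: sum.cartesian_product case_prod_unfold)
qed

lemma pure_tensor_Nil: "pure_tensor A [] u = (if u = [] then 1 else 0)"
  by (auto simp: pure_tensor_def)

lemma pure_tensor_Cons: "pure_tensor A (y # ys) (b # u) = coord A y b * pure_tensor A ys u"
  by (simp add: pure_tensor_def prod.lessThan_Suc_shift del: prod.lessThan_Suc)

lemma pure_tensor_length: "length u \<noteq> length ys \<Longrightarrow> pure_tensor A ys u = 0"
  by (simp add: pure_tensor_def)

lemma pure_tensor_append:
  "length u = length xs \<Longrightarrow>
    pure_tensor A (xs @ ys) (u @ w) = pure_tensor A xs u * pure_tensor A ys w"
  by (induction u xs rule: list_induct2) (simp_all add: pure_tensor_Nil pure_tensor_Cons)

lemma pure_tensor_in_tpow: "pure_tensor A ys \<in> tpow A (length ys)"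
proof -
  have "pure_tensor A ys u = 0" if "u \<notin> words A (length ys)" for u
  proof (cases "length u = length ys")
    case True
    with that obtain l where "l < length ys" "u ! l \<notin> basis A"
      by (auto simp: words_def subset_eq in_set_conv_nth)
    then show ?thesis
      by (auto simp: pure_tensor_def intro!: prod_zero bexI[of _ l] coord_outside)
  qed (simp add: pure_tensor_length)
  then show ?thesis by (simp add: tpow_def)
qed

lemma pure_tensor_basis:
  "v \<in> words A n \<Longrightarrow> pure_tensor A v u = (if u = v then 1 else 0)"
proof (induction n arbitrary: u v)
  case 0
  then show ?case by (simp add: words_0 pure_tensor_Nil)
next
  case (Suc n)
  then obtain b v' where v: "v = b # v'" "b \<in> basis A" "v' \<in> words A n"
    by (auto simp: words_def length_Suc_conv)
  then show ?case
    using Suc.IH[of v'] by (cases u) (auto simp: pure_tensor_Cons coord_basis pure_tensor_length)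
qed

text \<open>The tensors of the basis elements form a basis, and pure tensors are multilinear.\<close>

lemma tpow_expand:
  "x \<in> tpow A n \<Longrightarrow> x = (\<lambda>u. \<Sum>v\<in>words A n. x v * pure_tensor A v u)"
  by (rule ext)
     (auto simp: pure_tensor_basis tpow_def if_distrib finite_words sum.delta' cong: if_cong)

lemma pure_tensor_linear:
  "pure_tensor A (xs @ (scale A c y + z) # ys) u =
    c * pure_tensor A (xs @ y # ys) u + pure_tensor A (xs @ z # ys) u"
proof (cases "length u = length xs + Suc (length ys)")
  case True
  define v w where "v = take (length xs) u" and "w = drop (length xs) u"
  have u: "u = v @ w" and lv: "length v = length xs" and lw: "length w = Suc (length ys)"
    using True by (simp_all add: v_def w_def)
  from lw obtain b w' where "w = b # w'"
    by (cases w) auto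
  with u lv show ?thesis
    by (simp add: pure_tensor_append pure_tensor_Cons coord_add coord_scale algebra_simps)
qed (simp add: pure_tensor_length)

lemma tmult_pure_tensor:
  assumes "length xs = length ys"
  shows "pure_tensor A xs \<odot> pure_tensor A ys = pure_tensor A (map2 (*) xs ys)"
proof
  fix u
  let ?S = "\<lambda>n xs ys u. \<Sum>v\<in>words A n. \<Sum>w\<in>words A n.
    pure_tensor A xs v * pure_tensor A ys w * pure_tensor A (map2 (*) v w) u"
  have "?S (length u) xs ys u = pure_tensor A (map2 (*) xs ys) u"
    using assms
  proof (induction xs ys arbitrary: u rule: list_induct2)
    case Nil
    show ?case
    proof (cases u)
      case Nil
      then show ?thesis by (simp add: words_0 pure_tensor_Nil)
    next
      case (Cons b u')
      have "pure_tensor A [] v = 0" if "v \<in> words A (length u)" for v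
        using that Cons by (auto simp: words_def pure_tensor_Nil)
      then show ?thesis using Cons by (simp add: pure_tensor_Nil)
    qed
  next
    case (Cons x xs y ys)
    show ?case
    proof (cases u)
      case Nil
      then show ?thesis by (simp add: words_0 pure_tensor_length)
    next
      case (Cons b u')
      have "?S (length u) (x # xs) (y # ys) u =
        (\<Sum>p\<in>basis A. \<Sum>v\<in>words A (length u'). \<Sum>q\<in>basis A. \<Sum>w\<in>words A (length u').
          (coord A x p * coord A y q * coord A (p * q) b) *
          (pure_tensor A xs v * pure_tensor A ys w * pure_tensor A (map2 (*) v w) u'))"
        by (simp add: Cons sum_words_Suc pure_tensor_Cons ac_simps)
      also have "\<dots> = (\<Sum>p\<in>basis A. \<Sum>q\<in>basis A. \<Sum>v\<in>words A (length u'). \<Sum>w\<in>words A (length u').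
          (coord A x p * coord A y q * coord A (p * q) b) *
          (pure_tensor A xs v * pure_tensor A ys w * pure_tensor A (map2 (*) v w) u'))"
        by (intro sum.cong refl sum.swap)
      also have "\<dots> = (\<Sum>p\<in>basis A. \<Sum>q\<in>basis A. coord A x p * coord A y q * coord A (p * q) b) *
          ?S (length u') xs ys u'"
        by (simp only: sum_distrib_left[symmetric] sum_distrib_right[symmetric])
      also have "\<dots> = pure_tensor A (map2 (*) (x # xs) (y # ys)) u"
        by (simp add: Cons.IH Cons pure_tensor_Cons flip: coord_mult)
      finally show ?thesis .
    qed
  qed
  then show "(pure_tensor A xs \<odot> pure_tensor A ys) u = pure_tensor A (map2 (*) xs ys) u"
    by (simp add: tmult_def)
qed

lemma place_pure_tensor:
  assumes "i \<in> {1..n}" "j \<in> {1..n}" "i \<noteq> j"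
  shows "place A n i j (pure_tensor A [a, b]) =
    pure_tensor A ((replicate n 1)[i - 1 := a, j - 1 := b])"
proof
  fix u
  let ?g = "\<lambda>l. coord A ((replicate n 1)[i - 1 := a, j - 1 := b] ! l) (u ! l)"
  have ij: "i - 1 < n" "j - 1 < n" "i - 1 \<noteq> j - 1"
    using assms by auto
  have "(\<Prod>l<n. ?g l) = ?g (i - 1) * (?g (j - 1) * (\<Prod>l\<in>{..<n} - {i - 1} - {j - 1}. ?g l))"
    using ij by (simp add: prod.remove[of _ "i - 1"] prod.remove[of _ "j - 1"])
  also have "(\<Prod>l\<in>{..<n} - {i - 1} - {j - 1}. ?g l) =
      (\<Prod>l\<in>{..<n} - {i - 1, j - 1}. coord A 1 (u ! l))"
    by (intro prod.cong) auto
  finally show "place A n i j (pure_tensor A [a, b]) u =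
      pure_tensor A ((replicate n 1)[i - 1 := a, j - 1 := b]) u"
    using ij by (simp add: place_def pure_tensor_def lessThan_Suc mult_ac)
qed

lemma flip_pure_tensor: "flip (pure_tensor A [a, b]) = pure_tensor A [b, a]"
proof
  fix u
  show "flip (pure_tensor A [a, b]) u = pure_tensor A [b, a] u"
  proof (cases "length u = 2")
    case True
    then obtain c d where "u = [c, d]"
      by (auto simp: length_Suc_conv numeral_2_eq_2)
    then show ?thesis
      by (simp add: flip_def pure_tensor_Cons pure_tensor_Nil)
  qed (simp add: flip_def pure_tensor_length)
qed

lemma ttimes_homogeneous:
  assumes "x \<in> tpow A m"
  shows "(x \<otimes> y) u = x (take m u) * y (drop m u)"
proof -
  have z: "x v = 0" if "length v \<noteq> m" for v
    using assms that by (auto simp: tpow_def words_def)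
  have "(\<Sum>k\<le>length u. x (take k u) * y (drop k u)) =
      (\<Sum>k\<le>length u. if k = m then x (take m u) * y (drop m u) else 0)"
    by (intro sum.cong) (auto simp: z)
  also have "\<dots> = x (take m u) * y (drop m u)"
    by (simp add: z)
  finally show ?thesis by (simp add: ttimes_def)
qed

lemma ttimes_pure_tensor:
  "pure_tensor A xs \<otimes> pure_tensor A ys = pure_tensor A (xs @ ys)"
proof
  fix u
  show "(pure_tensor A xs \<otimes> pure_tensor A ys) u = pure_tensor A (xs @ ys) u"
  proof (cases "length xs \<le> length u")
    case True
    then show ?thesis
      using pure_tensor_append[of "take (length xs) u" xs ys "drop (length xs) u"]
      by (simp add: ttimes_homogeneous[OF pure_tensor_in_tpow])
  qed (simp add: ttimes_homogeneous[OF pure_tensor_in_tpow] pure_tensor_length)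
qed

text \<open>
  In every bidegree the coproduct of a pure tensor is the matching summand of the
  deconcatenation formula.
\<close>

lemma coproduct_pure_tensor:
  "coproduct (\<lambda>n. if n = length ys then pure_tensor A ys else (\<lambda>_. 0)) i j =
    (\<lambda>u. \<Sum>k\<le>length ys. if i = k \<and> j = length ys - k
      then (pure_tensor A (take k ys) \<otimes> pure_tensor A (drop k ys)) u else 0)"
proof -
  have "(\<Sum>k\<le>length ys. if i = k \<and> j = length ys - k then f k else 0) =
      (if i + j = length ys then f i else 0)" for f :: "nat \<Rightarrow> 'k"
  proof -
    have "(\<Sum>k\<le>length ys. if i = k \<and> j = length ys - k then f k else 0) =
        (\<Sum>k\<le>length ys. if k = i then (if i + j = length ys then f i else 0) else 0)"
      by (intro sum.cong) auto
    then show ?thesis by simp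
  qed
  then show ?thesis
    by (auto simp: coproduct_def ttimes_pure_tensor)
qed

lemma coproduct_left_ttimes:
  "coproduct_left (\<lambda>m n. x m \<otimes> y n) i j k = coproduct x i j \<otimes> y k"
  by (simp add: coproduct_left_def coproduct_def)

lemma coproduct_right_ttimes:
  "coproduct_right (\<lambda>m n. x m \<otimes> y n) i j k = x i \<otimes> coproduct y j k"
  by (simp add: coproduct_right_def coproduct_def)

lemma counit_left_ttimes:
  assumes "x \<in> T1_space A"
  shows "counit_left (\<lambda>m n. x m \<otimes> y n) n = (\<lambda>w. counit x * y n w)"
proof -
  have "x 0 \<in> tpow A 0" using assms by (simp add: T1_space_def)
  then show ?thesis
    by (simp add: counit_left_def counit_def ttimes_homogeneous)
qed

lemma counit_right_ttimes:
  assumes "x \<in> T1_space A" "y \<in> T1_space A"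
  shows "counit_right (\<lambda>m n. x m \<otimes> y n) m = (\<lambda>u. x m u * counit y)"
proof
  fix u
  have x: "x m \<in> tpow A m" and y: "y 0 \<in> tpow A 0"
    using assms by (simp_all add: T1_space_def)
  have "x m (take m u) * y 0 (drop m u) = x m u * y 0 []"
  proof (cases "length u = m")
    case False
    then have "x m u = 0" and "length u > m \<Longrightarrow> y 0 (drop m u) = 0"
      using x y by (auto simp: tpow_def words_def)
    then show ?thesis
      using False by (cases "length u > m") auto
  qed simp
  then show "counit_right (\<lambda>m n. x m \<otimes> y n) m u = x m u * counit y"
    by (simp add: counit_right_def counit_def ttimes_homogeneous[OF x])
qed

end

end

theory Submission
  imports Defs
begin

text \<open>
  In bidegree (i, j, k) the twisting equation reads
  \<open>\<Phi>\<^bsup>i+j,k\<^esup> (\<Phi>\<^bsup>i,j\<^esup> \<otimes> 1) = \<Phi>\<^bsup>i,j+k\<^esup> (1 \<otimes> \<Phi>\<^bsup>j,k\<^esup>)\<close>.  For i = 1 it determines the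
  components with left degree m + 1 from those with left degree m and from the given family of
  components of bidegree (1, k); conversely the recursion so obtained solves all equations, by
  induction on i (\<open>ex1_twist_with_components\<close>).

  Let \<open>R\<^sub>a\<close> be R in the places a, a + 1 and let \<open>\<sigma>\<^sub>a\<close> interchange these places.  Membership of a
  component in the tensor square of the subbialgebra amounts to \<open>R\<^sub>a \<Phi>\<^bsup>m,n\<^esup> = \<sigma>\<^sub>a(\<Phi>\<^bsup>m,n\<^esup>) R\<^sub>a\<close> for every
  pair of adjacent places on the same side of the cut between m and m + 1.  The elements
  satisfying such an exchange relation are closed under products and under division by an
  invertible element that satisfies it too, so the relation can be carried around by the twisting
  equation:

  \<^item> Both places right of the cut (in \<open>exch_twist_component\<close>).  The product of the
    \<open>\<Phi>\<^bsub>1j\<^esub>\<close> over all j satisfies the relation by the first hypothesis on \<open>\<Phi>\<^bsup>1,1\<^esup>\<close> (\<open>exch_row_product\<close>);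
    the equation with i = 1 then gives the claim by induction on m.

  \<^item> The first two places, with m = 2.  Here \<open>\<Phi>\<^bsup>2,k\<^esup> \<Phi>\<^bsub>12\<^esub>\<close> is \<open>\<Phi>\<^bsub>12\<^esub>\<close> times the product of all \<open>\<Phi>\<^bsub>1j\<^esub>\<close>
    times the product of all \<open>\<Phi>\<^bsub>2j\<^esub>\<close>, with j > 2.  Conjugation by \<open>\<Phi>\<^bsub>12\<^esub>\<close> turns R into its
    twisted form, which by the second hypothesis interchanges the two products
    (\<open>two_row_product\<close>, \<open>exch_two_row_product\<close>).

  \<^item> The first two places with m > 2, by the equation with i = 2; and places a, a + 1 with
    a + 1 \<open>\<le>\<close> m, by splitting off the places before a, since every other factor in the equation
    is then covered by a case already settled.

  The passage from the exchange relations to the tensor product of subspaces is linear algebra: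
  a tensor all of whose columns lie in V and all of whose rows lie in W lies in \<open>V \<otimes> W\<close>, by
  Gaussian elimination (\<open>in_subspace_tensorI\<close>), and the exchange relation for a tensor is the
  defining condition of S for its slices (\<open>exch_slice\<close>).

  Places are counted from 0 in what follows.
\<close>

section \<open>Algebra structure of the tensor powers\<close>

definition linear_set :: "('k::field, 'a) tensor set \<Rightarrow> bool"
  where "linear_set V \<longleftrightarrow>
    (\<lambda>_. 0) \<in> V \<and> (\<forall>c. \<forall>x\<in>V. \<forall>y\<in>V. (\<lambda>u. c * x u + y u) \<in> V)"

lemma linear_set_zero: "linear_set V \<Longrightarrow> (\<lambda>_. 0) \<in> V"
  by (simp add: linear_set_def)

lemma linear_set_add: "linear_set V \<Longrightarrow> x \<in> V \<Longrightarrow> y \<in> V \<Longrightarrow> (\<lambda>u. c * x u + y u) \<in> V"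
  by (simp add: linear_set_def)

lemma linear_set_scale: "linear_set V \<Longrightarrow> x \<in> V \<Longrightarrow> (\<lambda>u. c * x u) \<in> V"
  using linear_set_add[of V x "\<lambda>_. 0" c] linear_set_zero[of V] by simp

lemma ttimes_linear:
  "(\<lambda>_. 0) \<otimes> z = (\<lambda>_. 0)"
  "z \<otimes> (\<lambda>_. 0) = (\<lambda>_. 0)"
  "(\<lambda>u. c * x u + y u) \<otimes> z = (\<lambda>u. c * (x \<otimes> z) u + (y \<otimes> z) u)"
  "z \<otimes> (\<lambda>u. c * x u + y u) = (\<lambda>u. c * (z \<otimes> x) u + (z \<otimes> y) u)"
  by (simp_all add: ttimes_def fun_eq_iff sum.distrib sum_distrib_left algebra_simps)

context fd_algebra
begin

lemma linear_set_tpow: "linear_set (tpow A n)"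
  by (simp add: linear_set_def tpow_def)

text \<open>
  Pure tensors span, so an identity that is linear in each argument only has to be checked on
  them.  All multiplicativity statements below are obtained in this way.
\<close>

lemma tpow_induct [consumes 1, case_names zero add pure]:
  assumes x: "x \<in> tpow A n"
    and zero: "Q (\<lambda>_. 0)"
    and add: "\<And>c x y. x \<in> tpow A n \<Longrightarrow> y \<in> tpow A n \<Longrightarrow> Q x \<Longrightarrow> Q y \<Longrightarrow> Q (\<lambda>u. c * x u + y u)"
    and pure: "\<And>ys. length ys = n \<Longrightarrow> Q (pure_tensor A ys)"
  shows "Q x"
proof -
  have "(\<lambda>u. \<Sum>v\<in>S. x v * pure_tensor A v u) \<in> tpow A n \<and>
      Q (\<lambda>u. \<Sum>v\<in>S. x v * pure_tensor A v u)"
    if "finite S" "S \<subseteq> words A n" for S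
    using that
  proof (induction S rule: finite_induct)
    case empty
    then show ?case by (simp add: zero linear_set_zero linear_set_tpow)
  next
    case (insert v S)
    have "length v = n" using insert.prems by (simp add: words_def)
    then show ?case
      using insert pure_tensor_in_tpow[of v]
      by (simp add: add pure linear_set_add linear_set_tpow)
  qed
  from this[OF finite_words subset_refl] show ?thesis
    using tpow_expand[OF x] by simp
qed

lemma tmult_zero_left: "(\<lambda>_. 0) \<odot> z = (\<lambda>_. 0)"
  and tmult_zero_right: "z \<odot> (\<lambda>_. 0) = (\<lambda>_. 0)"
  by (simp_all add: tmult_def)

lemma tmult_add_left: "(\<lambda>u. c * x u + y u) \<odot> z = (\<lambda>u. c * (x \<odot> z) u + (y \<odot> z) u)"
  and tmult_add_right: "z \<odot> (\<lambda>u. c * x u + y u) = (\<lambda>u. c * (z \<odot> x) u + (z \<odot> y) u)"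
  by (simp_all add: tmult_def fun_eq_iff sum.distrib sum_distrib_left algebra_simps)

lemma tmult_scale:
  "(\<lambda>u. c * x u) \<odot> z = (\<lambda>u. c * (x \<odot> z) u)"
  "z \<odot> (\<lambda>u. c * x u) = (\<lambda>u. c * (z \<odot> x) u)"
  by (simp_all add: tmult_def fun_eq_iff sum_distrib_left mult_ac)

lemmas tmult_linear = tmult_zero_left tmult_zero_right tmult_add_left tmult_add_right

lemma tmult_in_tpow:
  assumes "x \<in> tpow A n" "y \<in> tpow A n"
  shows "x \<odot> y \<in> tpow A n"
  using assms(1)
proof (induction rule: tpow_induct)
  case (pure xs)
  show ?case
    using assms(2)
  proof (induction rule: tpow_induct)
    case (pure ys)
    then show ?case
      using \<open>length xs = n\<close> pure_tensor_in_tpow[of "map2 (*) xs ys"]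
      by (simp add: tmult_pure_tensor)
  qed (simp_all add: tmult_linear linear_set_zero linear_set_add linear_set_tpow)
qed (simp_all add: tmult_linear linear_set_zero linear_set_add linear_set_tpow)

lemma tmult_assoc_tpow:
  assumes "x \<in> tpow A n" "y \<in> tpow A n" "z \<in> tpow A n"
  shows "x \<odot> y \<odot> z = x \<odot> (y \<odot> z)"
  using assms(1)
proof (induction rule: tpow_induct)
  case (pure xs)
  note xs = pure
  show ?case
    using assms(2)
  proof (induction rule: tpow_induct)
    case (pure ys)
    note ys = pure
    show ?case
      using assms(3)
    proof (induction rule: tpow_induct)
      case (pure zs)
      have "map2 (*) (map2 (*) xs ys) zs = map2 (*) xs (map2 (*) ys zs)"
        using xs ys pure by (intro nth_equalityI) (simp_all add: mult.assoc)
      then show ?case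
        using xs ys pure by (simp add: tmult_pure_tensor)
    qed (simp_all add: tmult_linear)
  qed (simp_all add: tmult_linear)
qed (simp_all add: tmult_linear)

text \<open>
  The product in degree n only sees the coefficients of its factors on words of length n, so
  associativity needs no homogeneity.
\<close>

lemma tmult_assoc: "x \<odot> y \<odot> z = x \<odot> (y \<odot> z)"
proof
  fix u :: "'a list"
  define n where "n = length u"
  define h where "h = (\<lambda>(x::('k, 'a) tensor) v. if v \<in> words A n then x v else 0)"
  have h_tpow: "h x \<in> tpow A n" for x
    by (simp add: h_def tpow_def)
  have h_at: "(h x \<odot> h y) v = (x \<odot> y) v" if "length v = n" for x y v
    using that by (simp add: tmult_def h_def)
  have h_mult: "h (x \<odot> y) = h x \<odot> h y" for x y
  proof
    fix v
    show "h (x \<odot> y) v = (h x \<odot> h y) v"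
    proof (cases "v \<in> words A n")
      case True
      then have "h (x \<odot> y) v = (x \<odot> y) v" and "length v = n"
        by (simp_all add: h_def words_def)
      then show ?thesis by (simp add: h_at)
    next
      case False
      then show ?thesis
        using tmult_in_tpow[OF h_tpow h_tpow, of x y] by (simp add: h_def tpow_def)
    qed
  qed
  have "(x \<odot> y \<odot> z) u = (h x \<odot> h y \<odot> h z) u"
    using h_at[of u "x \<odot> y" z] by (simp add: h_mult n_def)
  also have "\<dots> = (h x \<odot> (h y \<odot> h z)) u"
    by (simp add: tmult_assoc_tpow[OF h_tpow h_tpow h_tpow])
  also have "\<dots> = (x \<odot> (y \<odot> z)) u"
    using h_at[of u x "y \<odot> z"] by (simp add: h_mult n_def)
  finally show "(x \<odot> y \<odot> z) u = (x \<odot> (y \<odot> z)) u" .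
qed

lemma tone_in_tpow: "tone A n \<in> tpow A n"
  using pure_tensor_in_tpow[of "replicate n 1"] by (simp add: tone_def)

lemma tmult_tone_left: "x \<in> tpow A n \<Longrightarrow> tone A n \<odot> x = x"
proof (induction rule: tpow_induct)
  case (pure ys)
  then have "map2 (*) (replicate n 1) ys = ys"
    by (intro nth_equalityI) simp_all
  then show ?case using pure by (simp add: tone_def tmult_pure_tensor)
qed (simp_all add: tmult_linear)

lemma tmult_tone_right: "x \<in> tpow A n \<Longrightarrow> x \<odot> tone A n = x"
proof (induction rule: tpow_induct)
  case (pure ys)
  then have "map2 (*) ys (replicate n 1) = ys"
    by (intro nth_equalityI) simp_all
  then show ?case using pure by (simp add: tone_def tmult_pure_tensor)
qed (simp_all add: tmult_linear)

lemma tinvertible_in_tpow: "tinvertible A n x \<Longrightarrow> x \<in> tpow A n"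
  by (simp add: tinvertible_def)

text \<open>
  The inverse is given by a definite description, which denotes because two-sided inverses are
  unique.
\<close>

lemma tinv_works:
  assumes "tinvertible A n x"
  shows "tinv A n x \<in> tpow A n" "x \<odot> tinv A n x = tone A n" "tinv A n x \<odot> x = tone A n"
proof -
  obtain y where y: "y \<in> tpow A n \<and> x \<odot> y = tone A n \<and> y \<odot> x = tone A n"
    using assms by (auto simp: tinvertible_def)
  have "z = y" if z: "z \<in> tpow A n \<and> x \<odot> z = tone A n \<and> z \<odot> x = tone A n" for z
  proof -
    have "z = z \<odot> (x \<odot> y)" using y z by (simp add: tmult_tone_right)
    also have "\<dots> = z \<odot> x \<odot> y" by (simp only: tmult_assoc)
    also have "\<dots> = y" using y z by (simp add: tmult_tone_left)
    finally show ?thesis .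
  qed
  from theI[of "\<lambda>y. y \<in> tpow A n \<and> x \<odot> y = tone A n \<and> y \<odot> x = tone A n", OF y this]
  show "tinv A n x \<in> tpow A n" "x \<odot> tinv A n x = tone A n" "tinv A n x \<odot> x = tone A n"
    unfolding tinv_def by blast+
qed

lemma tinvertible_tone: "tinvertible A n (tone A n)"
  unfolding tinvertible_def using tone_in_tpow tmult_tone_left[OF tone_in_tpow] by blast

lemma tinvertible_tmult:
  assumes "tinvertible A n x" "tinvertible A n y"
  shows "tinvertible A n (x \<odot> y)"
proof -
  note x = tinv_works[OF assms(1)] tinvertible_in_tpow[OF assms(1)]
  note y = tinv_works[OF assms(2)] tinvertible_in_tpow[OF assms(2)]
  let ?z = "tinv A n y \<odot> tinv A n x"
  have "x \<odot> y \<odot> ?z = x \<odot> (y \<odot> tinv A n y) \<odot> tinv A n x"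
    by (simp only: tmult_assoc)
  then have 1: "x \<odot> y \<odot> ?z = tone A n"
    by (simp add: x y tmult_tone_right)
  have "?z \<odot> (x \<odot> y) = tinv A n y \<odot> (tinv A n x \<odot> x) \<odot> y"
    by (simp only: tmult_assoc)
  then have 2: "?z \<odot> (x \<odot> y) = tone A n"
    by (simp add: x y tmult_tone_right)
  show ?thesis
    unfolding tinvertible_def using 1 2 x y by (blast intro: tmult_in_tpow)
qed

lemma tinvertible_tinv: "tinvertible A n x \<Longrightarrow> tinvertible A n (tinv A n x)"
  using tinv_works[of n x] tinvertible_in_tpow[of n x] by (auto simp: tinvertible_def)

lemma tmult_cancel_right:
  assumes "tinvertible A n y" "x \<in> tpow A n" "x' \<in> tpow A n" "x \<odot> y = x' \<odot> y"
  shows "x = x'"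
proof -
  have "x \<odot> (y \<odot> tinv A n y) = x' \<odot> (y \<odot> tinv A n y)"
    using assms(4) by (simp flip: tmult_assoc)
  then show ?thesis
    using assms by (simp add: tinv_works tmult_tone_right)
qed

section \<open>Embeddings along lists of positions\<close>

text \<open>
  The list js gives the places to which the tensor factors are sent, in order, and the remaining
  places are filled with the unit.  One construction thus covers \<open>x \<otimes> 1\<close>, \<open>1 \<otimes> x\<close>, the elements
  with factors in places i and j, and the permutations of the tensor factors; by \<open>emb_emb\<close>
  their compositions reduce to computations with lists of numbers.
\<close>

definition emb :: "nat \<Rightarrow> nat list \<Rightarrow> ('k, 'a) tensor \<Rightarrow> ('k, 'a) tensor"
  where "emb n js x = (\<lambda>u. if length u = n
    then x (map (nth u) js) * (\<Prod>l\<in>{..<n} - set js. coord A 1 (u ! l)) else 0)"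

definition positions :: "nat \<Rightarrow> nat list \<Rightarrow> bool"
  where "positions n js \<longleftrightarrow> distinct js \<and> set js \<subseteq> {..<n}"

lemma emb_zero: "emb n js (\<lambda>_. 0) = (\<lambda>_. 0)"
  and emb_add: "emb n js (\<lambda>u. c * x u + y u) = (\<lambda>u. c * emb n js x u + emb n js y u)"
  by (auto simp: emb_def fun_eq_iff algebra_simps)

lemmas emb_linear = emb_zero emb_add

lemma emb_in_tpow:
  assumes "x \<in> tpow A (length js)" "set js \<subseteq> {..<n}"
  shows "emb n js x \<in> tpow A n"
proof -
  have "emb n js x u = 0" if u: "u \<notin> words A n" for u
  proof (cases "length u = n")
    case True
    with u obtain l where l: "l < n" "u ! l \<notin> basis A"
      by (auto simp: words_def subset_eq in_set_conv_nth)
    show ?thesis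
    proof (cases "l \<in> set js")
      case True
      then have "map (nth u) js \<notin> words A (length js)"
        using l by (auto simp: words_def)
      then show ?thesis using assms by (simp add: emb_def tpow_def)
    next
      case False
      then have "(\<Prod>l\<in>{..<n} - set js. coord A 1 (u ! l)) = 0"
        using l by (intro prod_zero) (auto intro!: bexI[of _ l] coord_outside)
      then show ?thesis by (simp add: emb_def)
    qed
  qed (simp add: emb_def)
  then show ?thesis by (simp add: tpow_def)
qed

lemma emb_pure_tensor:
  assumes js: "positions n js" and g: "\<And>l. l \<notin> set js \<Longrightarrow> g l = 1"
  shows "emb n js (pure_tensor A (map g js)) = pure_tensor A (map g [0..<n])"
proof
  fix u
  show "emb n js (pure_tensor A (map g js)) u = pure_tensor A (map g [0..<n]) u"
  proof (cases "length u = n")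
    case True
    have "(\<Prod>k<length js. coord A (g (js ! k)) (u ! (js ! k))) =
        (\<Prod>l\<in>set js. coord A (g l) (u ! l))"
      using js by (intro prod.reindex_bij_betw bij_betw_nth) (auto simp: positions_def)
    moreover have "(\<Prod>l\<in>{..<n} - set js. coord A 1 (u ! l)) =
        (\<Prod>l\<in>{..<n} - set js. coord A (g l) (u ! l))"
      using g by (intro prod.cong) auto
    moreover have "(\<Prod>l<n. coord A (g l) (u ! l)) =
        (\<Prod>l\<in>{..<n} - set js. coord A (g l) (u ! l)) * (\<Prod>l\<in>set js. coord A (g l) (u ! l))"
      using js by (intro prod.subset_diff) (auto simp: positions_def)
    ultimately show ?thesis
      using True by (simp add: emb_def pure_tensor_def mult.commute)
  qed (simp add: emb_def pure_tensor_length)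
qed

text \<open>
  A list of algebra elements placed at js is a function on places with value 1 off js.  Products
  of embedded pure tensors are then pointwise products of functions, whatever the order of js.
\<close>

lemma positions_values:
  assumes "positions n js" "length ys = length js"
  obtains g where "ys = map g js" "\<And>l. l \<notin> set js \<Longrightarrow> g l = (1::'a)"
proof
  let ?g = "\<lambda>l. case map_of (zip js ys) l of None \<Rightarrow> 1 | Some y \<Rightarrow> y"
  show "ys = map ?g js"
    using assms by (intro nth_equalityI) (auto simp: positions_def map_of_zip_nth)
  show "?g l = 1" if "l \<notin> set js" for l
  proof -
    have "map_of (zip js ys) l = None"
      using that assms by simp
    then show ?thesis by simp
  qed
qed

lemma map2_map_map: "map2 f (map g xs) (map h xs) = map (\<lambda>x. f (g x) (h x)) xs"
  by (induction xs) auto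

lemma emb_tmult:
  assumes js: "positions n js" and m: "length js = m" and "x \<in> tpow A m" "y \<in> tpow A m"
  shows "emb n js (x \<odot> y) = emb n js x \<odot> emb n js y"
  using assms(3)
proof (induction rule: tpow_induct)
  case (pure xs)
  then obtain g where g: "xs = map g js" "\<And>l. l \<notin> set js \<Longrightarrow> g l = 1"
    using positions_values[OF js, of xs] m by metis
  show ?case
    using assms(4)
  proof (induction rule: tpow_induct)
    case (pure ys)
    then obtain h where h: "ys = map h js" "\<And>l. l \<notin> set js \<Longrightarrow> h l = 1"
      using positions_values[OF js, of ys] m by metis
    show ?case
      using js g(2) h(2)
      by (simp add: g(1) h(1) tmult_pure_tensor map2_map_map emb_pure_tensor)
  qed (simp_all add: tmult_linear emb_linear)
qed (simp_all add: tmult_linear emb_linear)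

text \<open>
  At every place one of the two factors is the unit.
\<close>

lemma emb_commute:
  assumes js: "positions n js" and ks: "positions n ks" and disj: "set js \<inter> set ks = {}"
    and "x \<in> tpow A (length js)" "y \<in> tpow A (length ks)"
  shows "emb n js x \<odot> emb n ks y = emb n ks y \<odot> emb n js x"
  using assms(4)
proof (induction rule: tpow_induct)
  case (pure xs)
  then obtain g where g: "xs = map g js" "\<And>l. l \<notin> set js \<Longrightarrow> g l = 1"
    using positions_values[OF js, of xs] by metis
  show ?case
    using assms(5)
  proof (induction rule: tpow_induct)
    case (pure ys)
    then obtain h where h: "ys = map h ks" "\<And>l. l \<notin> set ks \<Longrightarrow> h l = 1"
      using positions_values[OF ks, of ys] by metis
    have "g l * h l = h l * g l" for l
      using g(2)[of l] h(2)[of l] disj by (metis disjoint_iff mult_1_left mult_1_right)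
    then show ?case
      using js ks g(2) h(2)
      by (simp add: g(1) h(1) emb_pure_tensor tmult_pure_tensor map2_map_map)
  qed (simp_all add: tmult_linear emb_linear)
qed (simp_all add: tmult_linear emb_linear)

lemma emb_tone:
  assumes "positions n js" "length js = m"
  shows "emb n js (tone A m) = tone A n"
  using emb_pure_tensor[OF assms(1), of "\<lambda>_. 1"] assms(2)
  by (simp add: tone_def map_replicate_const)

lemma emb_emb:
  assumes ks: "positions n ks" and m: "length ks = m" and js: "set js \<subseteq> {..<m}"
  shows "emb n ks (emb m js x) = emb n (map (nth ks) js) x"
proof
  fix u
  show "emb n ks (emb m js x) u = emb n (map (nth ks) js) x u"
  proof (cases "length u = n")
    case True
    let ?c = "\<lambda>l. coord A 1 (u ! l)"
    have inj: "inj_on (nth ks) {..<m}"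
      using ks m by (simp add: inj_on_nth positions_def)
    have img: "nth ks ` {..<m} = set ks"
      using m by (auto simp: set_conv_nth)
    have 0: "(\<Prod>p\<in>{..<m} - set js. coord A 1 (map (nth u) ks ! p)) =
        (\<Prod>p\<in>{..<m} - set js. ?c (ks ! p))"
      using m by (intro prod.cong) auto
    have "(\<Prod>p\<in>{..<m} - set js. ?c (ks ! p)) = (\<Prod>l\<in>nth ks ` ({..<m} - set js). ?c l)"
      using inj by (subst prod.reindex) (auto intro: inj_on_subset)
    also have "nth ks ` ({..<m} - set js) = set ks - nth ks ` set js"
      using inj_on_image_set_diff[OF inj, of "{..<m}" "set js"] js img by simp
    finally have 1: "(\<Prod>p\<in>{..<m} - set js. ?c (ks ! p)) =
        (\<Prod>l\<in>set ks - nth ks ` set js. ?c l)" .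
    have sub: "nth ks ` set js \<subseteq> set ks" "set ks \<subseteq> {..<n}"
      using js img ks by (auto simp: positions_def)
    have "(\<Prod>l\<in>{..<n} - nth ks ` set js. ?c l) =
        (\<Prod>l\<in>({..<n} - nth ks ` set js) - (set ks - nth ks ` set js). ?c l) *
        (\<Prod>l\<in>set ks - nth ks ` set js. ?c l)"
      using sub by (intro prod.subset_diff) auto
    also have "({..<n} - nth ks ` set js) - (set ks - nth ks ` set js) = {..<n} - set ks"
      using sub by auto
    finally have 2: "(\<Prod>l\<in>{..<n} - nth ks ` set js. ?c l) =
        (\<Prod>l\<in>{..<n} - set ks. ?c l) * (\<Prod>l\<in>set ks - nth ks ` set js. ?c l)" .
    have 3: "map (nth (map (nth u) ks)) js = map (nth u) (map (nth ks) js)"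
      using js m by auto
    show ?thesis
      using True m by (simp add: emb_def 0 1 2 3 del: map_map)
  qed (simp add: emb_def)
qed

lemma emb_id: "x \<in> tpow A n \<Longrightarrow> emb n [0..<n] x = x"
proof
  fix u
  assume "x \<in> tpow A n"
  then show "emb n [0..<n] x u = x u"
    by (cases "length u = n") (auto simp: emb_def map_nth tpow_def words_def atLeast0LessThan)
qed

lemma tinvertible_emb:
  assumes x: "tinvertible A m x" and js: "positions n js" and m: "length js = m"
  shows "tinvertible A n (emb n js x)"
proof -
  note y = tinv_works[OF x] and x' = tinvertible_in_tpow[OF x]
  have "emb n js (tinv A m x) \<in> tpow A n" "emb n js x \<in> tpow A n"
    using y x' js m by (simp_all add: emb_in_tpow positions_def)
  moreover have "emb n js x \<odot> emb n js (tinv A m x) = tone A n"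
    using emb_tmult[OF js m x' y(1)] y js m by (simp add: emb_tone)
  moreover have "emb n js (tinv A m x) \<odot> emb n js x = tone A n"
    using emb_tmult[OF js m y(1) x'] y js m by (simp add: emb_tone)
  ultimately show ?thesis by (auto simp: tinvertible_def)
qed

lemma place_eq_emb: "place A n i j x = emb n [i - 1, j - 1] x"
  by (rule ext) (simp add: place_def emb_def)

lemma ttimes_tone_eq_emb:
  assumes "x \<in> tpow A m"
  shows "x \<otimes> tone A k = emb (m + k) [0..<m] x"
  using assms
proof (induction rule: tpow_induct)
  case (pure ys)
  have pos: "positions (m + k) [0..<m]" by (auto simp: positions_def)
  then obtain g where g: "ys = map g [0..<m]" "\<And>l. l \<notin> set [0..<m] \<Longrightarrow> g l = 1"
    using positions_values[OF pos, of ys] pure by auto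
  have "map g [0..<m + k] = ys @ replicate k 1"
    using g(2) by (intro nth_equalityI) (auto simp: g(1) nth_append)
  then show ?case
    using emb_pure_tensor[OF pos, of g] g(2) by (simp add: tone_def ttimes_pure_tensor flip: g(1))
qed (simp_all add: emb_linear ttimes_linear)

lemma tone_ttimes_eq_emb:
  assumes "x \<in> tpow A m"
  shows "tone A i \<otimes> x = emb (i + m) [i..<i + m] x"
  using assms
proof (induction rule: tpow_induct)
  case (pure ys)
  have pos: "positions (i + m) [i..<i + m]" by (auto simp: positions_def)
  then obtain g where g: "ys = map g [i..<i + m]" "\<And>l. l \<notin> set [i..<i + m] \<Longrightarrow> g l = 1"
    using positions_values[OF pos, of ys] pure by auto
  have "map g [0..<i + m] = replicate i 1 @ ys"
    using g(2) by (intro nth_equalityI) (auto simp: g(1) nth_append)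
  then show ?case
    using emb_pure_tensor[OF pos, of g] g(2) by (simp add: tone_def ttimes_pure_tensor flip: g(1))
qed (simp_all add: emb_linear ttimes_linear)

lemma emb_tinv:
  assumes "tinvertible A m x" "positions n js" "length js = m"
  shows "emb n js (tinv A m x) \<odot> emb n js x = tone A n"
    and "emb n js x \<odot> emb n js (tinv A m x) = tone A n"
  using assms tinvertible_in_tpow[OF assms(1)] tinv_works[OF assms(1)]
  by (simp_all add: emb_tone flip: emb_tmult[OF assms(2,3)])

lemma positions_upt: "b \<le> n \<Longrightarrow> positions n [a..<b]"
  by (auto simp: positions_def)

lemma tone_ttimes_tone: "tone A m \<otimes> tone A n = tone A (m + n)"
  by (simp add: tone_def ttimes_pure_tensor replicate_add)

section \<open>Solving the twisting equation\<close>

lemma twisting_equation_iff: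
  assumes "\<Phi> \<in> T2_space A"
  shows "twisting_equation A \<Phi> \<longleftrightarrow> (\<forall>i j k.
    \<Phi> (i + j) k \<odot> emb (i + j + k) [0..<i + j] (\<Phi> i j) =
    \<Phi> i (j + k) \<odot> emb (i + j + k) [i..<i + j + k] (\<Phi> j k))"
proof -
  have \<Phi>: "\<Phi> m n \<in> tpow A (m + n)" for m n
    using assms by (simp add: T2_space_def)
  have "coproduct_left \<Phi> i j k = \<Phi> (i + j) k" "coproduct_right \<Phi> i j k = \<Phi> i (j + k)" for i j k
    by (simp_all add: coproduct_left_def coproduct_right_def coproduct_def)
  moreover have "T3_12 A \<Phi> i j k = emb (i + j + k) [0..<i + j] (\<Phi> i j)"
    and "T3_23 A \<Phi> i j k = emb (i + j + k) [i..<i + j + k] (\<Phi> j k)" for i j k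
    using ttimes_tone_eq_emb[OF \<Phi>] tone_ttimes_eq_emb[OF \<Phi>]
    by (simp_all add: T3_12_def T3_23_def T1_one_def add.assoc)
  moreover have "f = g \<longleftrightarrow> (\<forall>i j k. f i j k = g i j k)" for f g :: "('k, 'a) T3"
    by (simp add: fun_eq_iff)
  ultimately show ?thesis
    by (simp add: twisting_equation_def T3_mult_def)
qed

lemma normalized_iff:
  "normalized A \<Phi> \<longleftrightarrow> (\<forall>n. \<Phi> 0 n = tone A n) \<and> (\<forall>m. \<Phi> m 0 = tone A m)"
  by (auto simp: normalized_def counit_left_def counit_right_def counit_def T1_one_def fun_eq_iff)

lemma T2_invertible_iff: "T2_invertible A \<Phi> \<longleftrightarrow> (\<forall>m n. tinvertible A (m + n) (\<Phi> m n))"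
proof
  assume "T2_invertible A \<Phi>"
  then obtain \<Psi> where "\<Phi> \<in> T2_space A" "\<Psi> \<in> T2_space A"
    "T2_mult A \<Phi> \<Psi> = T2_one A" "T2_mult A \<Psi> \<Phi> = T2_one A"
    by (auto simp: T2_invertible_def)
  moreover from this have "\<Phi> m n \<odot> \<Psi> m n = tone A (m + n)" "\<Psi> m n \<odot> \<Phi> m n = tone A (m + n)" for m n
    unfolding T2_mult_def T2_one_def T1_one_def tone_ttimes_tone by metis+
  ultimately show "\<forall>m n. tinvertible A (m + n) (\<Phi> m n)"
    unfolding T2_space_def tinvertible_def by blast
next
  assume *: "\<forall>m n. tinvertible A (m + n) (\<Phi> m n)"
  define \<Psi> where "\<Psi> = (\<lambda>m n. tinv A (m + n) (\<Phi> m n))"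
  have "\<Psi> \<in> T2_space A" "\<Phi> \<in> T2_space A" "T2_mult A \<Phi> \<Psi> = T2_one A" "T2_mult A \<Psi> \<Phi> = T2_one A"
    using * by (simp_all add: T2_space_def \<Psi>_def tinv_works tinvertible_in_tpow T2_mult_def
        T2_one_def T1_one_def tone_ttimes_tone)
  then show "T2_invertible A \<Phi>"
    by (auto simp: T2_invertible_def)
qed

text \<open>
  The twisting equation with i = 1, solved for the component of left degree m + 1.
\<close>

primrec twist :: "(nat \<Rightarrow> ('k, 'a) tensor) \<Rightarrow> ('k, 'a) T2"
  where
    "twist F 0 n = tone A n"
  | "twist F (Suc m) n = F (m + n) \<odot> emb (Suc (m + n)) [1..<Suc (m + n)] (twist F m n) \<odot>
      emb (Suc (m + n)) [0..<Suc m] (tinv A (Suc m) (F m))"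

lemma map_nth_upt: "b \<le> c - a \<Longrightarrow> map (nth [a..<c]) [d..<b] = [a + d..<a + b]"
  by (intro nth_equalityI) (auto simp: ac_simps)

text \<open>
  Uniqueness holds because the equations with i = 1 are the recursion that defines
  \<open>twist\<close>.  For existence the remaining equations follow by induction on i: multiplied on the
  right by \<open>F\<^sub>i \<otimes> 1\<close>, both sides of the equation for i + 1 become \<open>F\<^bsub>i+j+k\<^esub>\<close> times the embedded
  equation for i.
\<close>

lemma ex1_twist_with_components:
  assumes F: "\<And>k. tinvertible A (Suc k) (F k)" and F0: "F 0 = tone A 1"
  shows "\<exists>!\<Phi>. twist_with_components A F \<Phi>"
proof
  let ?\<Phi> = "twist F"
  note F_tpow = tinvertible_in_tpow[OF F]
  have inv: "tinvertible A (m + n) (?\<Phi> m n)" for m n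
  proof (induction m)
    case (Suc m)
    have "tinvertible A (Suc (m + n)) (emb (Suc (m + n)) [1..<Suc (m + n)] (?\<Phi> m n))"
      using Suc by (rule tinvertible_emb) (simp_all add: positions_upt del: upt_Suc)
    moreover have "tinvertible A (Suc (m + n)) (emb (Suc (m + n)) [0..<Suc m] (tinv A (Suc m) (F m)))"
      using tinvertible_tinv[OF F] by (rule tinvertible_emb) (simp_all add: positions_upt del: upt_Suc)
    ultimately show ?case
      by (simp add: tinvertible_tmult F del: upt_Suc)
  qed (simp add: tinvertible_tone)
  have mem: "?\<Phi> m n \<in> tpow A (m + n)" for m n
    using inv by (rule tinvertible_in_tpow)
  \<comment> \<open>The recursion without inverses: the twisting equation for i = 1.\<close>
  have step: "?\<Phi> (Suc m) n \<odot> emb (Suc (m + n)) [0..<Suc m] (F m) =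
      F (m + n) \<odot> emb (Suc (m + n)) [1..<Suc (m + n)] (?\<Phi> m n)" for m n
  proof -
    have "emb (Suc (m + n)) [1..<Suc (m + n)] (?\<Phi> m n) \<in> tpow A (Suc (m + n))"
      by (intro emb_in_tpow) (auto simp: mem simp del: upt_Suc)
    moreover have "emb (Suc (m + n)) [0..<Suc m] (tinv A (Suc m) (F m)) \<odot>
        emb (Suc (m + n)) [0..<Suc m] (F m) = tone A (Suc (m + n))"
      by (intro emb_tinv F positions_upt) auto
    ultimately show ?thesis
      by (simp add: tmult_assoc tmult_tone_right del: upt_Suc)
  qed
  have right: "?\<Phi> m 0 = tone A m" for m
  proof (induction m)
    case (Suc m)
    have "emb (Suc m) [0..<Suc m] (tinv A (Suc m) (F m)) = tinv A (Suc m) (F m)"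
      by (intro emb_id tinv_works F)
    moreover have "emb (Suc m) [1..<Suc m] (tone A m) = tone A (Suc m)"
      by (intro emb_tone positions_upt) auto
    ultimately show ?case
      using Suc by (simp add: tmult_tone_right F_tpow tinv_works F del: upt_Suc)
  qed simp
  have eq: "?\<Phi> (i + j) k \<odot> emb (i + j + k) [0..<i + j] (?\<Phi> i j) =
      ?\<Phi> i (j + k) \<odot> emb (i + j + k) [i..<i + j + k] (?\<Phi> j k)" for i j k
  proof (induction i)
    case 0
    have "emb (j + k) [0..<j] (tone A j) = tone A (j + k)"
      by (intro emb_tone positions_upt) auto
    then show ?case
      using mem[of j k] by (simp add: tmult_tone_right tmult_tone_left emb_id)
  next
    case (Suc i)
    let ?N = "Suc (i + j + k)"
    let ?l = "\<lambda>m. emb ?N [0..<Suc m]" and ?r = "emb ?N [1..<?N]"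
    let ?L = "?\<Phi> (Suc i + j) k \<odot> ?l (i + j) (?\<Phi> (Suc i) j)"
    let ?R = "?\<Phi> (Suc i) (j + k) \<odot> emb ?N [Suc i..<?N] (?\<Phi> j k)"
    have "?L \<odot> ?l i (F i) = ?\<Phi> (Suc i + j) k \<odot>
        ?l (i + j) (?\<Phi> (Suc i) j \<odot> emb (Suc (i + j)) [0..<Suc i] (F i))"
    proof -
      have "?l (i + j) (emb (Suc (i + j)) [0..<Suc i] (F i)) = ?l i (F i)"
        by (subst emb_emb) (auto simp: positions_upt map_nth_upt simp del: upt_Suc)
      moreover have "emb (Suc (i + j)) [0..<Suc i] (F i) \<in> tpow A (Suc (i + j))"
        by (intro emb_in_tpow) (auto simp: F_tpow simp del: upt_Suc)
      ultimately show ?thesis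
        using mem[of "Suc i" j]
        by (subst emb_tmult) (auto simp: positions_upt tmult_assoc simp del: upt_Suc twist.simps)
    qed
    also have "\<dots> = ?\<Phi> (Suc i + j) k \<odot>
        ?l (i + j) (F (i + j) \<odot> emb (Suc (i + j)) [1..<Suc (i + j)] (?\<Phi> i j))"
      by (simp only: step)
    also have "\<dots> = (?\<Phi> (Suc (i + j)) k \<odot> ?l (i + j) (F (i + j))) \<odot>
        emb ?N [1..<Suc (i + j)] (?\<Phi> i j)"
    proof -
      have "?l (i + j) (emb (Suc (i + j)) [1..<Suc (i + j)] (?\<Phi> i j)) =
          emb ?N [1..<Suc (i + j)] (?\<Phi> i j)"
        by (subst emb_emb) (auto simp: positions_upt map_nth_upt simp del: upt_Suc)
      moreover have "emb (Suc (i + j)) [1..<Suc (i + j)] (?\<Phi> i j) \<in> tpow A (Suc (i + j))"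
        by (intro emb_in_tpow) (auto simp: mem simp del: upt_Suc)
      ultimately show ?thesis
        by (subst emb_tmult)
          (auto simp: positions_upt tmult_assoc F_tpow simp del: upt_Suc twist.simps)
    qed
    also have "\<dots> = F (i + j + k) \<odot> (?r (?\<Phi> (i + j) k) \<odot> emb ?N [1..<Suc (i + j)] (?\<Phi> i j))"
      using step[of "i + j" k] by (simp only: tmult_assoc)
    also have "?r (?\<Phi> (i + j) k) \<odot> emb ?N [1..<Suc (i + j)] (?\<Phi> i j) =
        ?r (?\<Phi> (i + j) k \<odot> emb (i + j + k) [0..<i + j] (?\<Phi> i j))"
    proof -
      have "?r (emb (i + j + k) [0..<i + j] (?\<Phi> i j)) = emb ?N [1..<Suc (i + j)] (?\<Phi> i j)"
        by (subst emb_emb) (auto simp: positions_upt map_nth_upt simp del: upt_Suc)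
      moreover have "emb (i + j + k) [0..<i + j] (?\<Phi> i j) \<in> tpow A (i + j + k)"
        by (intro emb_in_tpow) (auto simp: mem simp del: upt_Suc)
      ultimately show ?thesis
        using mem[of "i + j" k]
        by (subst emb_tmult) (auto simp: positions_upt simp del: upt_Suc)
    qed
    also have "?\<Phi> (i + j) k \<odot> emb (i + j + k) [0..<i + j] (?\<Phi> i j) =
        ?\<Phi> i (j + k) \<odot> emb (i + j + k) [i..<i + j + k] (?\<Phi> j k)"
      by (rule Suc.IH)
    also have "?r (?\<Phi> i (j + k) \<odot> emb (i + j + k) [i..<i + j + k] (?\<Phi> j k)) =
        ?r (?\<Phi> i (j + k)) \<odot> emb ?N [Suc i..<?N] (?\<Phi> j k)"
    proof -
      have "?r (emb (i + j + k) [i..<i + j + k] (?\<Phi> j k)) = emb ?N [Suc i..<?N] (?\<Phi> j k)"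
        by (subst emb_emb) (auto simp: positions_upt map_nth_upt simp del: upt_Suc)
      moreover have "emb (i + j + k) [i..<i + j + k] (?\<Phi> j k) \<in> tpow A (i + j + k)"
        by (intro emb_in_tpow) (auto simp: mem simp del: upt_Suc)
      ultimately show ?thesis
        using mem[of i "j + k"]
        by (subst emb_tmult) (auto simp: positions_upt ac_simps simp del: upt_Suc)
    qed
    also have "F (i + j + k) \<odot> (?r (?\<Phi> i (j + k)) \<odot> emb ?N [Suc i..<?N] (?\<Phi> j k)) =
        ?\<Phi> (Suc i) (j + k) \<odot> (?l i (F i) \<odot> emb ?N [Suc i..<?N] (?\<Phi> j k))"
      using step[of i "j + k"] by (simp only: add.assoc flip: tmult_assoc)
    also have "?l i (F i) \<odot> emb ?N [Suc i..<?N] (?\<Phi> j k) =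
        emb ?N [Suc i..<?N] (?\<Phi> j k) \<odot> ?l i (F i)"
      using mem[of j k]
      by (intro emb_commute positions_upt) (auto simp: F_tpow simp del: upt_Suc)
    finally have "?L \<odot> ?l i (F i) = ?R \<odot> ?l i (F i)"
      by (simp only: tmult_assoc)
    moreover have "tinvertible A ?N (?l i (F i))"
      by (rule tinvertible_emb[OF F]) (simp_all add: positions_upt del: upt_Suc)
    moreover have "?L \<in> tpow A ?N" "?R \<in> tpow A ?N"
      using mem[of "Suc i + j" k] mem[of "Suc i" j] mem[of "Suc i" "j + k"] mem[of j k]
      by (auto intro!: tmult_in_tpow emb_in_tpow simp: add.assoc simp del: upt_Suc twist.simps)
    ultimately have "?L = ?R"
      by (meson tmult_cancel_right)
    then show ?case by (simp only: add_Suc)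
  qed
  have "?\<Phi> 1 k = F k" for k
  proof -
    have "emb (Suc k) [1..<Suc k] (tone A k) = tone A (Suc k)"
      by (intro emb_tone positions_upt) auto
    then have "?\<Phi> 1 k \<odot> emb (Suc k) [0..<Suc 0] (tone A 1) = F k"
      using step[of 0 k] F0 by (simp add: tmult_tone_right F_tpow del: upt_Suc)
    moreover have "emb (Suc k) [0..<Suc 0] (tone A 1) = tone A (Suc k)"
      by (intro emb_tone positions_upt) auto
    ultimately show ?thesis
      using mem[of 1 k] by (simp add: tmult_tone_right del: twist.simps)
  qed
  moreover have "?\<Phi> \<in> T2_space A"
    by (simp add: T2_space_def mem)
  ultimately show "twist_with_components A F ?\<Phi>"
    using inv right eq twist.simps(1)[of F]
    by (simp add: twist_with_components_def T2_invertible_iff normalized_iff twisting_equation_iff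
        del: twist.simps)
next
  fix \<Psi>
  assume \<Psi>: "twist_with_components A F \<Psi>"
  then have inv: "tinvertible A (m + n) (\<Psi> m n)" for m n
    by (simp add: twist_with_components_def T2_invertible_iff)
  have mem: "\<Psi> m n \<in> tpow A (m + n)" for m n
    using inv by (rule tinvertible_in_tpow)
  then have "\<Psi> \<in> T2_space A" by (simp add: T2_space_def)
  with \<Psi> have eq: "\<Psi> (i + j) k \<odot> emb (i + j + k) [0..<i + j] (\<Psi> i j) =
      \<Psi> i (j + k) \<odot> emb (i + j + k) [i..<i + j + k] (\<Psi> j k)" for i j k
    by (simp add: twist_with_components_def twisting_equation_iff)
  have unit: "\<Psi> 0 n = tone A n" "\<Psi> n 0 = tone A n" for n
    using \<Psi> by (simp_all add: twist_with_components_def normalized_iff)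
  have one: "\<Psi> 1 k = F k" for k
    using \<Psi> F0 unit(2)[of 1] by (cases k) (simp_all add: twist_with_components_def)
  have "\<Psi> m n = twist F m n" for m n
  proof (induction m)
    case (Suc m)
    let ?l = "emb (Suc (m + n)) [0..<Suc m]"
    have inv_F: "?l (F m) \<odot> ?l (tinv A (Suc m) (F m)) = tone A (Suc (m + n))"
      by (intro emb_tinv F positions_upt) auto
    have "\<Psi> (Suc m) n = \<Psi> (Suc m) n \<odot> ?l (F m) \<odot> ?l (tinv A (Suc m) (F m))"
      using mem[of "Suc m" n] by (simp add: tmult_assoc inv_F tmult_tone_right del: upt_Suc)
    also have "\<Psi> (Suc m) n \<odot> ?l (F m) = F (m + n) \<odot> emb (Suc (m + n)) [1..<Suc (m + n)] (\<Psi> m n)"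
      using eq[of 1 m n] one by (simp del: upt_Suc)
    finally show ?case by (simp add: Suc.IH del: upt_Suc)
  qed (simp add: unit)
  then show "\<Psi> = twist F" by blast
qed

end

definition swap_adj :: "nat \<Rightarrow> nat \<Rightarrow> nat"
  where "swap_adj a = id(a := Suc a, Suc a := a)"

lemma swap_adj_simps [simp]:
  "swap_adj a a = Suc a" "swap_adj a (Suc a) = a"
  "l \<noteq> a \<Longrightarrow> l \<noteq> Suc a \<Longrightarrow> swap_adj a l = l"
  by (simp_all add: swap_adj_def)

lemma swap_adj_shift: "swap_adj (i + a) (i + l) = i + swap_adj a l"
  by (simp add: swap_adj_def)

lemma swap_adj_swap_adj: "swap_adj a (swap_adj a l) = l"
  by (simp add: swap_adj_def)

lemma swap_adj_less: "Suc a < N \<Longrightarrow> l < N \<Longrightarrow> swap_adj a l < N"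
  by (simp add: swap_adj_def)

context fd_algebra
begin

section \<open>Elements on which the R-matrix acts as a flip\<close>

abbreviation swap :: "nat \<Rightarrow> nat \<Rightarrow> ('k, 'a) tensor \<Rightarrow> ('k, 'a) tensor"
  where "swap N a \<equiv> emb N (map (swap_adj a) [0..<N])"

definition exch :: "('k, 'a) tensor \<Rightarrow> nat \<Rightarrow> nat \<Rightarrow> ('k, 'a) tensor \<Rightarrow> bool"
  where "exch R N a x \<longleftrightarrow>
    x \<in> tpow A N \<and> emb N [a, Suc a] R \<odot> x = swap N a x \<odot> emb N [a, Suc a] R"

lemma positions_map_swap_adj:
  assumes "Suc a < N" "positions N js"
  shows "positions N (map (swap_adj a) js)"
proof -
  have "inj (swap_adj a)"
    by (metis injI swap_adj_swap_adj)
  then show ?thesis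
    using assms by (auto simp: positions_def distinct_map swap_adj_less intro: inj_on_subset)
qed

lemma swap_emb:
  assumes "Suc a < N" "positions N js"
  shows "swap N a (emb N js x) = emb N (map (swap_adj a) js) x"
proof -
  have "swap N a (emb N js x) = emb N (map (nth (map (swap_adj a) [0..<N])) js) x"
    using assms by (intro emb_emb) (auto simp: positions_map_swap_adj positions_upt positions_def[of _ js])
  also have "map (nth (map (swap_adj a) [0..<N])) js = map (swap_adj a) js"
    using assms(2) by (auto simp: positions_def)
  finally show ?thesis .
qed

lemma swap_tmult:
  assumes "Suc a < N" "x \<in> tpow A N" "y \<in> tpow A N"
  shows "swap N a (x \<odot> y) = swap N a x \<odot> swap N a y"
  using assms by (intro emb_tmult) (simp_all add: positions_map_swap_adj positions_upt)

lemma swap_in_tpow: "Suc a < N \<Longrightarrow> x \<in> tpow A N \<Longrightarrow> swap N a x \<in> tpow A N"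
  by (intro emb_in_tpow) (auto simp: swap_adj_less)

lemma exch_in_tpow: "exch R N a x \<Longrightarrow> x \<in> tpow A N"
  by (simp add: exch_def)

lemma exch_tmult:
  assumes "Suc a < N" "exch R N a x" "exch R N a y"
  shows "exch R N a (x \<odot> y)"
proof -
  let ?R = "emb N [a, Suc a] R"
  have "?R \<odot> (x \<odot> y) = ?R \<odot> x \<odot> y" by (simp only: tmult_assoc)
  also have "\<dots> = swap N a x \<odot> (?R \<odot> y)"
    using assms(2) by (simp add: exch_def tmult_assoc)
  also have "\<dots> = swap N a (x \<odot> y) \<odot> ?R"
    using assms by (simp add: exch_def tmult_assoc swap_tmult)
  finally show ?thesis
    using assms by (simp add: exch_def tmult_in_tpow)
qed

text \<open>
  Division by an invertible element: in the twisting equation the component of interest always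
  occurs as a left factor, next to an embedded component of smaller degree.
\<close>

lemma exch_cancel:
  assumes a: "Suc a < N" and R: "R \<in> tpow A 2" and xy: "exch R N a (x \<odot> y)"
    and y: "exch R N a y" "tinvertible A N y" and x: "x \<in> tpow A N"
  shows "exch R N a x"
proof -
  let ?R = "emb N [a, Suc a] R"
  note yN = exch_in_tpow[OF y(1)]
  have RN: "?R \<in> tpow A N"
    using a R by (intro emb_in_tpow) (auto simp: numeral_2_eq_2)
  have "?R \<odot> x \<odot> y = swap N a x \<odot> swap N a y \<odot> ?R"
    using xy a x yN by (simp add: exch_def tmult_assoc swap_tmult)
  also have "\<dots> = swap N a x \<odot> ?R \<odot> y"
    using y(1) by (simp add: exch_def tmult_assoc)
  finally have "?R \<odot> x = swap N a x \<odot> ?R"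
    using a y(2) x RN by (auto intro!: tmult_cancel_right[of N y] tmult_in_tpow swap_in_tpow)
  with x show ?thesis by (simp add: exch_def)
qed

text \<open>
  Away from the places a and a + 1 there is nothing to flip, and R in these places commutes.
\<close>

lemma exch_emb_disjoint:
  assumes "Suc a < N" "R \<in> tpow A 2" "positions N js" "x \<in> tpow A (length js)"
    and "a \<notin> set js" "Suc a \<notin> set js"
  shows "exch R N a (emb N js x)"
proof -
  have "map (swap_adj a) js = js"
    using assms(5,6) by (intro map_idI) (metis swap_adj_simps(3))
  then have "swap N a (emb N js x) = emb N js x"
    using assms(1,3) by (simp add: swap_emb)
  moreover have "emb N [a, Suc a] R \<odot> emb N js x = emb N js x \<odot> emb N [a, Suc a] R"
    using assms by (intro emb_commute) (auto simp: positions_def numeral_2_eq_2)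
  moreover have "emb N js x \<in> tpow A N"
    using assms(3,4) by (intro emb_in_tpow) (auto simp: positions_def)
  ultimately show ?thesis by (simp add: exch_def)
qed

lemma exch_tone:
  assumes "Suc a < N" "R \<in> tpow A 2"
  shows "exch R N a (tone A N)"
proof -
  have "emb N [] (tone A 0) = tone A N"
    by (intro emb_tone) (auto simp: positions_def)
  then show ?thesis
    using exch_emb_disjoint[OF assms, of "[]" "tone A 0"] tone_in_tpow[of 0]
    by (simp add: positions_def)
qed

lemma exch_emb_interval:
  assumes a: "Suc a < M" and R: "R \<in> tpow A 2" and x: "exch R M a x" and N: "i + M \<le> N"
  shows "exch R N (i + a) (emb N [i..<i + M] x)"
proof -
  let ?e = "emb N [i..<i + M]"
  have pos: "positions N [i..<i + M]" using N by (intro positions_upt)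
  note xM = exch_in_tpow[OF x]
  have RM: "emb M [a, Suc a] R \<in> tpow A M"
    using a R by (intro emb_in_tpow) (auto simp: numeral_2_eq_2)
  have eR: "?e (emb M [a, Suc a] R) = emb N [i + a, Suc (i + a)] R"
    using a pos by (subst emb_emb) auto
  have "map (nth [i..<i + M]) (map (swap_adj a) [0..<M]) = map (swap_adj (i + a)) [i..<i + M]"
    using a by (intro nth_equalityI) (auto simp: swap_adj_less swap_adj_shift)
  then have es: "?e (swap M a x) = swap N (i + a) (?e x)"
    using a pos N by (subst emb_emb, simp, simp, fastforce simp: swap_adj_less, subst swap_emb) auto
  have "?e (emb M [a, Suc a] R \<odot> x) = ?e (swap M a x \<odot> emb M [a, Suc a] R)"
    using x by (simp add: exch_def)
  then have "emb N [i + a, Suc (i + a)] R \<odot> ?e x = swap N (i + a) (?e x) \<odot> emb N [i + a, Suc (i + a)] R"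
    using emb_tmult[OF pos _ RM xM] emb_tmult[OF pos _ swap_in_tpow[OF a xM] RM]
    by (simp add: eR es)
  moreover have "?e x \<in> tpow A N"
    using xM N by (intro emb_in_tpow) auto
  ultimately show ?thesis by (simp add: exch_def)
qed

lemma exch_foldl:
  assumes "Suc a < N" "exch R N a x" "\<And>y. y \<in> set ys \<Longrightarrow> exch R N a y"
  shows "exch R N a (foldl (\<odot>) x ys)"
  using assms by (induction ys arbitrary: x) (auto intro: exch_tmult)

lemma foldl_tmult_in_tpow:
  "x \<in> tpow A n \<Longrightarrow> set ys \<subseteq> tpow A n \<Longrightarrow> foldl (\<odot>) x ys \<in> tpow A n"
  by (induction ys arbitrary: x) (auto intro: tmult_in_tpow)

lemma foldl_tmult:
  "x \<in> tpow A n \<Longrightarrow> foldl (\<odot>) x ys = x \<odot> foldl (\<odot>) (tone A n) ys"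
  by (induction ys rule: rev_induct) (simp_all add: tmult_tone_right tmult_assoc)

lemma emb_foldl_tmult:
  assumes "positions n js" "length js = m" "set ys \<subseteq> tpow A m"
  shows "emb n js (foldl (\<odot>) (tone A m) ys) = foldl (\<odot>) (tone A n) (map (emb n js) ys)"
  using assms(3)
  by (induction ys rule: rev_induct)
    (simp_all add: emb_tone[OF assms(1,2)] emb_tmult[OF assms(1,2)] foldl_tmult_in_tpow tone_in_tpow)

lemma emb_tmult3:
  assumes "positions n js" "length js = m" "x \<in> tpow A m" "y \<in> tpow A m" "z \<in> tpow A m"
  shows "emb n js (x \<odot> y \<odot> z) = emb n js x \<odot> emb n js y \<odot> emb n js z"
  using assms by (simp add: emb_tmult[OF assms(1,2)] tmult_in_tpow)

text \<open>
  The factors with j different from a and a + 1 avoid the two places of R, while the pair of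
  factors at j = a and j = a + 1 has its order reversed by R, which is also what the flip does to it.
\<close>

lemma exch_row_product:
  assumes R: "R \<in> tpow A 2" and P: "P \<in> tpow A 2" and a: "1 \<le> a" "Suc a < N"
    and rel: "emb 3 [1, 2] R \<odot> emb 3 [0, 1] P \<odot> emb 3 [0, 2] P =
      emb 3 [0, 2] P \<odot> emb 3 [0, 1] P \<odot> emb 3 [1, 2] R"
  shows "exch R N a (foldl (\<odot>) (tone A N) (map (\<lambda>j. emb N [0, j] P) [1..<N]))"
proof -
  let ?P = "\<lambda>j. emb N [0, j] P"
  have P_tpow: "emb n [i, j] P \<in> tpow A n" if "i < n" "j < n" for n i j
    using that P by (intro emb_in_tpow) (auto simp: numeral_2_eq_2)
  have R_tpow: "emb n [i, j] R \<in> tpow A n" if "i < n" "j < n" for n i j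
    using that R by (intro emb_in_tpow) (auto simp: numeral_2_eq_2)
  have other: "exch R N a (?P j)" if "1 \<le> j" "j < N" "j \<noteq> a" "j \<noteq> Suc a" for j
    using that a R P by (intro exch_emb_disjoint) (auto simp: positions_def numeral_2_eq_2)
  have pair: "exch R N a (?P a \<odot> ?P (Suc a))"
  proof -
    let ?e = "emb N [0, a, Suc a]"
    have pos: "positions N [0, a, Suc a]" using a by (auto simp: positions_def)
    have mult: "?e (x \<odot> y \<odot> z) = ?e x \<odot> ?e y \<odot> ?e z"
      if "x \<in> tpow A 3" "y \<in> tpow A 3" "z \<in> tpow A 3" for x y z
      using that by (intro emb_tmult3[OF pos]) auto
    have ee: "?e (emb 3 [1, 2] R) = emb N [a, Suc a] R" "?e (emb 3 [0, 1] P) = ?P a"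
      "?e (emb 3 [0, 2] P) = ?P (Suc a)"
      using pos by (simp_all add: emb_emb)
    have "emb N [a, Suc a] R \<odot> ?P a \<odot> ?P (Suc a) = ?P (Suc a) \<odot> ?P a \<odot> emb N [a, Suc a] R"
      using arg_cong[OF rel, of ?e] by (simp add: mult P_tpow R_tpow ee[unfolded One_nat_def])
    moreover have "swap N a (?P a \<odot> ?P (Suc a)) = ?P (Suc a) \<odot> ?P a"
      using a by (simp add: swap_tmult P_tpow swap_emb positions_def)
    moreover have "?P a \<odot> ?P (Suc a) \<in> tpow A N"
      using a by (intro tmult_in_tpow P_tpow) auto
    ultimately show ?thesis by (simp add: exch_def tmult_assoc)
  qed
  have "[1..<N] = [1..<a] @ [a, Suc a] @ [Suc (Suc a)..<N]"
    using a upt_add_eq_append[of 1 a "N - a"] by (simp add: upt_conv_Cons)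
  then have split: "foldl (\<odot>) (tone A N) (map ?P [1..<N]) =
      foldl (\<odot>) (foldl (\<odot>) (tone A N) (map ?P [1..<a]) \<odot> (?P a \<odot> ?P (Suc a))) (map ?P [Suc (Suc a)..<N])"
    by (simp add: tmult_assoc)
  show ?thesis
    unfolding split
  proof (intro exch_foldl[OF a(2)] exch_tmult[OF a(2) _ pair] exch_tone[OF a(2)] R)
    show "exch R N a y" if "y \<in> set (map ?P [1..<a])" for y
      using that other a by (auto simp del: upt_Suc)
    show "exch R N a y" if "y \<in> set (map ?P [Suc (Suc a)..<N])" for y
      using that other a by (auto simp del: upt_Suc)
  qed
qed

text \<open>
  The index list grows by one at a time.  The new \<open>P\<^bsub>0j\<^esub>\<close> commutes with the old product of the
  \<open>P\<^bsub>1l\<^esub>\<close>, since their places are disjoint, so it can be brought next to the new \<open>P\<^bsub>1j\<^esub>\<close>, where the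
  relation in three places applies.
\<close>

lemma two_row_product:
  assumes Q: "Q \<in> tpow A 2" and P: "P \<in> tpow A 2" and js: "distinct js" "set js \<subseteq> {2..<N}"
    and N: "2 \<le> N"
    and rel: "emb 3 [0, 1] Q \<odot> emb 3 [0, 2] P \<odot> emb 3 [1, 2] P =
      emb 3 [1, 2] P \<odot> emb 3 [0, 2] P \<odot> emb 3 [0, 1] Q"
  defines "Z \<equiv> \<lambda>i. foldl (\<odot>) (tone A N) (map (\<lambda>j. emb N [i, j] P) js)"
  shows "emb N [0, 1] Q \<odot> (Z 0 \<odot> Z 1) = Z 1 \<odot> Z 0 \<odot> emb N [0, 1] Q"
  unfolding Z_def using js
proof (induction js rule: rev_induct)
  case Nil
  have "emb N [0, 1] Q \<in> tpow A N"
    using Q N by (intro emb_in_tpow) (auto simp: numeral_2_eq_2)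
  then show ?case by (simp add: tmult_tone_left tmult_tone_right tone_in_tpow)
next
  case (snoc j js)
  let ?P = "\<lambda>i j. emb N [i, j] P" and ?Q = "emb N [0, 1] Q"
  let ?Z = "\<lambda>i. foldl (\<odot>) (tone A N) (map (?P i) js)"
  have P_tpow: "emb n [i, j] P \<in> tpow A n" if "i < n" "j < n" for n i j
    using that P by (intro emb_in_tpow) (auto simp: numeral_2_eq_2)
  have Q_tpow: "emb n [i, j] Q \<in> tpow A n" if "i < n" "j < n" for n i j
    using that Q by (intro emb_in_tpow) (auto simp: numeral_2_eq_2)
  have j: "2 \<le> j" "j < N" "j \<notin> set js" using snoc.prems by auto
  have IH: "?Q \<odot> (?Z 0 \<odot> ?Z 1) = ?Z 1 \<odot> ?Z 0 \<odot> ?Q"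
    using snoc by simp
  have rel_j: "?Q \<odot> (?P 0 j \<odot> ?P 1 j) = ?P 1 j \<odot> (?P 0 j \<odot> ?Q)"
  proof -
    let ?e = "emb N [0, 1, j]"
    have pos: "positions N [0, 1, j]" using j by (auto simp: positions_def)
    have mult: "?e (x \<odot> y \<odot> z) = ?e x \<odot> ?e y \<odot> ?e z"
      if "x \<in> tpow A 3" "y \<in> tpow A 3" "z \<in> tpow A 3" for x y z
      using that by (intro emb_tmult3[OF pos]) auto
    have ee: "?e (emb 3 [0, 1] Q) = ?Q" "?e (emb 3 [0, 2] P) = ?P 0 j"
      "?e (emb 3 [1, 2] P) = ?P 1 j"
      using pos by (simp_all add: emb_emb)
    have "?Q \<odot> ?P 0 j \<odot> ?P 1 j = ?P 1 j \<odot> ?P 0 j \<odot> ?Q"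
      using arg_cong[OF rel, of ?e] 
      by (simp add: mult[unfolded One_nat_def] P_tpow Q_tpow ee[unfolded One_nat_def])
    then show ?thesis by (simp only: tmult_assoc)
  qed
  have comm: "?Z i \<odot> ?P i' j = ?P i' j \<odot> ?Z i" if "i < 2" "i' < 2" "i \<noteq> i'" for i i'
  proof -
    have "?P i l \<odot> ?P i' j = ?P i' j \<odot> ?P i l" if "l \<in> set js" for l
      using that \<open>i < 2\<close> \<open>i' < 2\<close> \<open>i \<noteq> i'\<close> j snoc.prems P
      by (intro emb_commute) (auto simp: positions_def numeral_2_eq_2)
    then have "foldl (\<odot>) (tone A N) (map (?P i) ls) \<odot> ?P i' j =
        ?P i' j \<odot> foldl (\<odot>) (tone A N) (map (?P i) ls)" if "set ls \<subseteq> set js" for ls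
      using that
    proof (induction ls rule: rev_induct)
      case Nil
      then show ?case
        using \<open>i' < 2\<close> j P_tpow by (simp add: tmult_tone_left tmult_tone_right)
    next
      case (snoc l ls)
      then show ?case by simp (metis tmult_assoc)
    qed
    then show ?thesis by blast
  qed
  have "?Q \<odot> ((?Z 0 \<odot> ?P 0 j) \<odot> (?Z 1 \<odot> ?P 1 j)) = ?Q \<odot> (?Z 0 \<odot> ?Z 1) \<odot> (?P 0 j \<odot> ?P 1 j)"
    using comm[of 1 0] by (simp add: tmult_assoc) (metis tmult_assoc)
  also have "\<dots> = ?Z 1 \<odot> ?Z 0 \<odot> (?Q \<odot> (?P 0 j \<odot> ?P 1 j))"
    by (simp only: IH tmult_assoc)
  also have "\<dots> = ?Z 1 \<odot> (?Z 0 \<odot> ?P 1 j) \<odot> (?P 0 j \<odot> ?Q)"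
    by (simp only: rel_j tmult_assoc)
  also have "\<dots> = (?Z 1 \<odot> ?P 1 j) \<odot> (?Z 0 \<odot> ?P 0 j) \<odot> ?Q"
    using comm[of 0 1] by (simp add: tmult_assoc)
  finally show ?case by simp
qed

text \<open>
  With Q the product of the two rows and Q' its flip, \<open>P\<^bsub>10\<^esub> Rt = R P\<^bsub>01\<^esub>\<close> gives
  \<open>R x P\<^bsub>01\<^esub> = R P\<^bsub>01\<^esub> Q = P\<^bsub>10\<^esub> Rt Q = P\<^bsub>10\<^esub> Q' Rt = \<sigma>(x) P\<^bsub>10\<^esub> Rt = \<sigma>(x) R P\<^bsub>01\<^esub>\<close>, and \<open>P\<^bsub>01\<^esub>\<close> cancels.
\<close>

lemma exch_two_row_product:
  assumes R: "tinvertible A 2 R" and P: "tinvertible A 2 P"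
    and Rt: "Rt = tinv A 2 (emb 2 [1, 0] P) \<odot> R \<odot> P"
    and rel2: "emb 3 [0, 1] Rt \<odot> emb 3 [0, 2] P \<odot> emb 3 [1, 2] P =
      emb 3 [1, 2] P \<odot> emb 3 [0, 2] P \<odot> emb 3 [0, 1] Rt"
    and N: "2 \<le> N" and x: "x \<in> tpow A N"
  defines "Z \<equiv> \<lambda>i. foldl (\<odot>) (tone A N) (map (\<lambda>j. emb N [i, j] P) [2..<N])"
  assumes prod: "x \<odot> emb N [0, 1] P = emb N [0, 1] P \<odot> (Z 0 \<odot> Z 1)"
  shows "exch R N 0 x"
proof -
  let ?P = "\<lambda>i j. emb N [i, j] P"
  note Rm = tinvertible_in_tpow[OF R] and Pm = tinvertible_in_tpow[OF P]
  have P_tpow: "?P i j \<in> tpow A N" if "i < N" "j < N" for i j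
    using that Pm by (intro emb_in_tpow) (auto simp: numeral_2_eq_2)
  have row: "set (map (?P i) [2..<N]) \<subseteq> tpow A N" if "i < N" for i
    using that by (auto intro!: P_tpow)
  have Z_tpow: "Z i \<in> tpow A N" if "i < N" for i
    unfolding Z_def using that by (intro foldl_tmult_in_tpow tone_in_tpow row)
  have P21: "tinvertible A 2 (emb 2 [1, 0] P)"
    using P by (rule tinvertible_emb) (auto simp: positions_def)
  note P21_inv = tinv_works[OF P21] tinvertible_in_tpow[OF P21]
  have Rt_tpow: "Rt \<in> tpow A 2"
    unfolding Rt by (intro tmult_in_tpow P21_inv Rm Pm)
  have swap_Z: "swap N 0 (Z i) = Z (swap_adj 0 i)" if "i < 2" for i
  proof -
    have "swap N 0 (?P i j) = ?P (swap_adj 0 i) j" if "2 \<le> j" "j < N" for j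
      using that \<open>i < 2\<close> swap_emb[of 0 N "[i, j]" P] by (simp add: positions_def)
    then have rows: "map (swap N 0) (map (?P i) [2..<N]) = map (?P (swap_adj 0 i)) [2..<N]"
      unfolding map_map by (intro map_cong refl) (simp only: set_upt atLeastLessThan_iff o_apply)
    have pos: "positions N (map (swap_adj 0) [0..<N])"
      using N by (simp add: positions_map_swap_adj positions_upt)
    have len: "length (map (swap_adj 0) [0..<N]) = N" by simp
    have "set (map (?P i) [2..<N]) \<subseteq> tpow A N"
      using that N by (intro row) simp
    then show ?thesis
      by (simp only: Z_def emb_foldl_tmult[OF pos len] rows)
  qed
  have swap_P: "swap N 0 (?P 0 1) = ?P 1 0"
    using N swap_adj_simps(2)[of 0] by (simp add: swap_emb positions_def)
  have swap_prod: "swap N 0 (?P 0 1 \<odot> (Z 0 \<odot> Z 1)) = ?P 1 0 \<odot> (Z 1 \<odot> Z 0)"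
    using N swap_Z[of 0] swap_Z[of 1] swap_adj_simps(2)[of 0]
    by (simp add: swap_tmult swap_P[unfolded One_nat_def] P_tpow Z_tpow tmult_in_tpow)
  have Rt_P: "?P 1 0 \<odot> emb N [0, 1] Rt = emb N [0, 1] R \<odot> ?P 0 1"
  proof -
    have pos: "positions N [0, 1]" using N by (simp add: positions_def)
    have "emb 2 [1, 0] P \<odot> Rt = (emb 2 [1, 0] P \<odot> tinv A 2 (emb 2 [1, 0] P)) \<odot> (R \<odot> P)"
      unfolding Rt by (simp only: tmult_assoc)
    then have "emb 2 [1, 0] P \<odot> Rt = R \<odot> P"
      by (simp add: P21_inv[unfolded One_nat_def] tmult_tone_left tmult_in_tpow Rm Pm)
    from arg_cong[OF this, of "emb N [0, 1]"] show ?thesis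
      using emb_tmult[OF pos _ P21_inv(4) Rt_tpow] emb_tmult[OF pos _ Rm Pm] pos
      by (simp add: emb_emb)
  qed
  let ?R = "emb N [0, 1] R"
  have "?R \<odot> x \<odot> ?P 0 1 = ?R \<odot> ?P 0 1 \<odot> (Z 0 \<odot> Z 1)"
    by (simp only: tmult_assoc prod)
  also have "\<dots> = ?P 1 0 \<odot> (emb N [0, 1] Rt \<odot> (Z 0 \<odot> Z 1))"
    by (simp only: Rt_P[symmetric] tmult_assoc)
  also have "\<dots> = ?P 1 0 \<odot> (Z 1 \<odot> Z 0 \<odot> emb N [0, 1] Rt)"
    using two_row_product[OF Rt_tpow Pm _ _ _ rel2, of "[2..<N]" N] N by (simp add: Z_def)
  also have "\<dots> = swap N 0 (x \<odot> ?P 0 1) \<odot> emb N [0, 1] Rt"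
    by (simp only: prod swap_prod tmult_assoc)
  also have "\<dots> = swap N 0 x \<odot> (?P 1 0 \<odot> emb N [0, 1] Rt)"
    using N by (simp add: swap_tmult x P_tpow swap_P[unfolded One_nat_def] tmult_assoc)
  also have "\<dots> = swap N 0 x \<odot> ?R \<odot> ?P 0 1"
    by (simp only: Rt_P tmult_assoc)
  finally have cancel: "?R \<odot> x \<odot> ?P 0 1 = swap N 0 x \<odot> ?R \<odot> ?P 0 1" .
  have R_tpow: "?R \<in> tpow A N"
    using N Rm by (intro emb_in_tpow) (auto simp: numeral_2_eq_2)
  have P_inv: "tinvertible A N (?P 0 1)"
    using P by (rule tinvertible_emb) (use N in \<open>auto simp: positions_def\<close>)
  have "swap N 0 x \<in> tpow A N"
    using N x by (intro swap_in_tpow) simp_all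
  then have "?R \<odot> x = swap N 0 x \<odot> ?R"
    using tmult_cancel_right[OF P_inv _ _ cancel] tmult_in_tpow R_tpow x by blast
  then show ?thesis using x by (simp add: exch_def)
qed

text \<open>
  The case Suc a = m is the excluded one: there the places a and a + 1 lie on different sides of
  the cut.
\<close>

lemma exch_twist_component:
  assumes R: "tinvertible A 2 R" and P: "tinvertible A 2 P"
    and Rt: "Rt = tinv A 2 (emb 2 [1, 0] P) \<odot> R \<odot> P"
    and rel1: "emb 3 [1, 2] R \<odot> emb 3 [0, 1] P \<odot> emb 3 [0, 2] P =
      emb 3 [0, 2] P \<odot> emb 3 [0, 1] P \<odot> emb 3 [1, 2] R"
    and rel2: "emb 3 [0, 1] Rt \<odot> emb 3 [0, 2] P \<odot> emb 3 [1, 2] P =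
      emb 3 [1, 2] P \<odot> emb 3 [0, 2] P \<odot> emb 3 [0, 1] Rt"
    and F: "\<And>k. F k = foldl (\<odot>) (tone A (Suc k)) (map (\<lambda>j. emb (Suc k) [0, j] P) [1..<Suc k])"
    and \<Phi>: "twist_with_components A F \<Phi>"
    and a: "Suc a < m + n" "Suc a \<noteq> m"
  shows "exch R (m + n) a (\<Phi> m n)"
proof -
  have inv: "tinvertible A (m + n) (\<Phi> m n)" for m n
    using \<Phi> by (simp add: twist_with_components_def T2_invertible_iff)
  have mem: "\<Phi> m n \<in> tpow A (m + n)" for m n
    using inv by (rule tinvertible_in_tpow)
  then have "\<Phi> \<in> T2_space A" by (simp add: T2_space_def)
  with \<Phi> have eq: "\<Phi> (i + j) k \<odot> emb (i + j + k) [0..<i + j] (\<Phi> i j) =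
      \<Phi> i (j + k) \<odot> emb (i + j + k) [i..<i + j + k] (\<Phi> j k)" for i j k
    by (simp add: twist_with_components_def twisting_equation_iff)
  have unit: "\<Phi> 0 n = tone A n" "\<Phi> n 0 = tone A n" for n
    using \<Phi> by (simp_all add: twist_with_components_def normalized_iff)
  have one: "\<Phi> 1 k = F k" for k
    using \<Phi> F[of 0] unit(2)[of 1] by (cases k) (simp_all add: twist_with_components_def)
  note Rm = tinvertible_in_tpow[OF R] and Pm = tinvertible_in_tpow[OF P]

  \<comment> \<open>Three of the four factors in the twisting equation determine the fourth.\<close>
  have step: "exch R N a (\<Phi> m k)"
    if N: "N = i + j + k" "m = i + j" and a: "Suc a < N"
      and 1: "exch R N a (\<Phi> i (j + k))" "exch R N a (emb N [i..<N] (\<Phi> j k))"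
      and 2: "exch R N a (emb N [0..<m] (\<Phi> i j))" for N m i j k a
  proof (rule exch_cancel[OF a Rm _ 2])
    show "exch R N a (\<Phi> m k \<odot> emb N [0..<m] (\<Phi> i j))"
      using eq[of i j k] exch_tmult[OF a 1] by (simp add: N)
    show "tinvertible A N (emb N [0..<m] (\<Phi> i j))"
      using inv by (rule tinvertible_emb) (simp_all add: positions_upt N)
    show "\<Phi> m k \<in> tpow A N" using mem by (simp add: N)
  qed

  have right: "exch R (m + n) a (\<Phi> m n)" if "m \<le> a" "Suc a < m + n" for m n a
    using that
  proof (induction m arbitrary: a)
    case 0
    then show ?case by (simp add: unit exch_tone Rm)
  next
    case (Suc m)
    obtain N where N: "N = Suc m + n" by simp
    obtain b where b: "a = 1 + b" using Suc.prems by (cases a) auto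
    have "exch R N a (\<Phi> 1 (m + n))"
      unfolding one F using exch_row_product[OF Rm Pm _ _ rel1, of a N] Suc.prems N
      by (simp del: upt_Suc)
    moreover have "exch R N a (emb N [1..<N] (\<Phi> m n))"
    proof -
      have "[1..<N] = [1..<1 + (m + n)]" using N by simp
      then show ?thesis
        using exch_emb_interval[of b "m + n" R "\<Phi> m n" 1 N] Suc b Rm N by (simp del: upt_Suc)
    qed
    moreover have "exch R N a (emb N [0..<Suc m] (\<Phi> 1 m))"
      using Suc.prems mem[of 1 m] Rm N
      by (intro exch_emb_disjoint) (auto simp: positions_upt simp del: upt_Suc)
    ultimately show ?case
      using step[where i = 1 and j = m and k = n and a = a and N = N] Suc.prems N by simp
  qed

  have two: "exch R (2 + k) 0 (\<Phi> 2 k)" for k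
  proof -
    obtain N where N: "N = Suc (Suc k)" by simp
    let ?P = "\<lambda>i j. emb N [i, j] P"
    let ?Z = "\<lambda>i. foldl (\<odot>) (tone A N) (map (?P i) [2..<N])"
    have P01: "?P 0 1 \<in> tpow A N"
      using N Pm by (intro emb_in_tpow) (auto simp: numeral_2_eq_2)
    have "emb N [0..<2] (\<Phi> 1 1) = ?P 0 1"
    proof -
      have "\<Phi> 1 1 = emb 2 [0, 1] P"
        using Pm by (simp add: one[simplified] F numeral_2_eq_2 tmult_tone_left emb_in_tpow)
      then show ?thesis using N by (simp add: emb_emb positions_upt del: upt_Suc)
    qed
    moreover have "\<Phi> 1 (Suc k) = ?P 0 1 \<odot> ?Z 0"
    proof -
      have "[1..<N] = 1 # [2..<N]" using N by (simp add: upt_conv_Cons numeral_2_eq_2 del: upt_Suc)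
      then have "\<Phi> 1 (Suc k) = foldl (\<odot>) (?P 0 1) (map (?P 0) [2..<N])"
        unfolding one F N[symmetric] using P01 by (simp add: tmult_tone_left)
      then show ?thesis
        using foldl_tmult[OF P01] by simp
    qed
    moreover have "emb N [1..<N] (\<Phi> 1 k) = ?Z 1"
    proof -
      have pos: "positions N [1..<N]" by (simp add: positions_upt)
      have "map (emb N [1..<N]) (map (\<lambda>j. emb (Suc k) [0, j] P) [1..<Suc k]) = map (?P 1) [2..<N]"
        using N by (intro nth_equalityI) (simp_all add: emb_emb positions_upt del: upt_Suc)
      moreover have "set (map (\<lambda>j. emb (Suc k) [0, j] P) [1..<Suc k]) \<subseteq> tpow A (Suc k)"
        using Pm by (auto intro!: emb_in_tpow simp: numeral_2_eq_2 simp del: upt_Suc)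
      moreover have "length [1..<N] = Suc k" using N by simp
      ultimately show ?thesis
        unfolding one F using emb_foldl_tmult[OF pos] by metis
    qed
    ultimately have "\<Phi> 2 k \<odot> ?P 0 1 = ?P 0 1 \<odot> (?Z 0 \<odot> ?Z 1)"
      using eq[of 1 1 k] N by (simp add: tmult_assoc numeral_2_eq_2 del: upt_Suc)
    then show ?thesis
      using exch_two_row_product[OF R P Rt rel2, of N "\<Phi> 2 k"] N mem[of 2 k] by simp
  qed

  have left0: "exch R (m + k) 0 (\<Phi> m k)" if m: "2 \<le> m" for m k
  proof -
    obtain N where N: "N = m + k" by simp
    obtain j where j: "m = 2 + j" using le_Suc_ex[OF m] by (elim exE)
    have "exch R N 0 (\<Phi> 2 (j + k))"
      using two[of "j + k"] N j by (simp add: add.assoc)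
    moreover have "exch R N 0 (emb N [2..<N] (\<Phi> j k))"
      using mem[of j k] Rm N j by (intro exch_emb_disjoint) (auto simp: positions_upt simp del: upt_Suc)
    moreover have "exch R N 0 (emb N [0..<m] (\<Phi> 2 j))"
      using exch_emb_interval[of 0 m R "\<Phi> 2 j" 0 N] two[of j] Rm N j by simp
    ultimately show ?thesis
      using step[OF _ j, of N k 0] N j by simp
  qed

  have left: "exch R (m + k) a (\<Phi> m k)" if am: "Suc a < m" for m k a
  proof -
    obtain N where N: "N = m + k" by simp
    obtain j where j: "m = a + j" "2 \<le> j"
    proof
      show "m = a + (m - a)" "2 \<le> m - a" using am by simp_all
    qed
    have "exch R N a (\<Phi> a (j + k))"
      using right[of a a "j + k"] N j am by (simp add: add.assoc)
    moreover have "exch R N a (emb N [a..<N] (\<Phi> j k))"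
      using exch_emb_interval[of 0 "j + k" R "\<Phi> j k" a N] left0[of j k] Rm N j
      by (simp add: add.assoc)
    moreover have "exch R N a (emb N [0..<m] (\<Phi> a j))"
      using exch_emb_interval[of a m R "\<Phi> a j" 0 N] right[of a a j] Rm N j am by simp
    ultimately show ?thesis
      using step[where N = N and m = m and i = a and j = j and k = k and a = a] N j(1) am by auto
  qed

  show ?thesis
  proof (cases "m \<le> a")
    case True
    then show ?thesis using right a(1) by blast
  next
    case False
    then show ?thesis using left[of a m n] a(2) by simp
  qed
qed

end

section \<open>Tensor products of subspaces\<close>

lemma elementary_in_subspace_tensor:
  assumes "x \<in> V" "y \<in> W"
  shows "x \<otimes> y \<in> V \<otimes>\<^sub>s W"
  unfolding subspace_tensor_def mem_Collect_eq using assms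
  by (rule_tac exI[of _ 1], rule_tac exI[of _ "\<lambda>_. x"], rule_tac exI[of _ "\<lambda>_. y"]) simp

lemma linear_set_subspace_tensor:
  fixes V W :: "('b::field, 'c) tensor set"
  assumes V: "linear_set V"
  shows "linear_set (V \<otimes>\<^sub>s W)"
  unfolding linear_set_def
proof (intro conjI allI ballI)
  show "(\<lambda>_. 0) \<in> V \<otimes>\<^sub>s W"
    unfolding subspace_tensor_def by (auto intro!: exI[of _ 0])
next
  fix c z z'
  assume "z \<in> V \<otimes>\<^sub>s W" "z' \<in> V \<otimes>\<^sub>s W"
  then obtain r s :: nat and x y x' y'
    where z: "\<forall>i<r. x i \<in> V \<and> y i \<in> W" "z = (\<lambda>u. \<Sum>i<r. (x i \<otimes> y i) u)"
      and z': "\<forall>i<s. x' i \<in> V \<and> y' i \<in> W" "z' = (\<lambda>u. \<Sum>i<s. (x' i \<otimes> y' i) u)"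
    unfolding subspace_tensor_def by blast
  let ?x = "\<lambda>i. if i < r then (\<lambda>u. c * x i u) else x' (i - r)"
  let ?y = "\<lambda>i. if i < r then y i else y' (i - r)"
  have "(\<Sum>i<r + s. (?x i \<otimes> ?y i) u) = c * z u + z' u" for u
  proof -
    have "(\<Sum>i<r + s. f i) = (\<Sum>i<r. f i) + (\<Sum>i<s. f (r + i))" for f :: "nat \<Rightarrow> 'b"
      by (induction s) (simp_all add: add.assoc)
    moreover have "((\<lambda>u. c * x i u) \<otimes> y i) u = c * (x i \<otimes> y i) u" for i
      by (simp add: ttimes_def sum_distrib_left mult.assoc)
    ultimately show ?thesis
      by (simp add: z z' sum_distrib_left)
  qed
  moreover have "\<forall>i<r + s. ?x i \<in> V \<and> ?y i \<in> W"
    using z(1) z'(1) linear_set_scale[OF V] by auto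
  ultimately show "(\<lambda>u. c * z u + z' u) \<in> V \<otimes>\<^sub>s W"
    unfolding subspace_tensor_def mem_Collect_eq
    by (rule_tac exI[of _ "r + s"], rule_tac exI[of _ ?x], rule_tac exI[of _ ?y]) simp
qed

lemma linear_set_Inter: "(\<And>V. V \<in> \<V> \<Longrightarrow> linear_set V) \<Longrightarrow> linear_set (\<Inter>\<V>)"
  by (simp add: linear_set_def)

context fd_algebra
begin

lemma slice_in_tpow:
  assumes "z \<in> tpow A (length u + m + length w)"
  shows "(\<lambda>v. z (u @ v @ w)) \<in> tpow A m"
  using assms by (auto simp: tpow_def words_def)

lemma ttimes_in_tpow:
  assumes x: "x \<in> tpow A m" and y: "y \<in> tpow A n"
  shows "x \<otimes> y \<in> tpow A (m + n)"
proof -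
  have "x (take m u) * y (drop m u) = 0" if "u \<notin> words A (m + n)" for u
  proof -
    have "set (take m u) \<union> set (drop m u) = set u"
      by (metis append_take_drop_id set_append)
    then have "take m u \<notin> words A m \<or> drop m u \<notin> words A n"
      using that by (auto simp: words_def)
    then show ?thesis using x y by (auto simp: tpow_def)
  qed
  then show ?thesis by (simp add: tpow_def ttimes_homogeneous[OF x])
qed

text \<open>
  Gaussian elimination on z, read as a matrix whose rows and columns are indexed by words.
  Subtracting the product of a pivot column and the pivot row, divided by the pivot, keeps
  rows in W and columns in V, annihilates the pivot row and creates no new nonzero row.
\<close>

lemma in_subspace_tensorI:
  assumes V: "linear_set V" and W: "linear_set W"
    and z: "z \<in> tpow A (m + n)"
    and col: "\<And>w. length w = n \<Longrightarrow> (\<lambda>u. z (u @ w)) \<in> V"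
    and row: "\<And>u. length u = m \<Longrightarrow> (\<lambda>w. z (u @ w)) \<in> W"
  shows "z \<in> V \<otimes>\<^sub>s W"
  using z col row
proof (induction "card {u \<in> words A m. \<exists>w. z (u @ w) \<noteq> 0}" arbitrary: z rule: less_induct)
  case less
  let ?rows = "\<lambda>z. {u \<in> words A m. \<exists>w. z (u @ w) \<noteq> 0}"
  show ?case
  proof (cases "z = (\<lambda>_. 0)")
    case True
    then show ?thesis by (simp add: linear_set_zero linear_set_subspace_tensor V)
  next
    case False
    then obtain t where t: "z t \<noteq> 0" by auto
    with less.prems(1) have "t \<in> words A (m + n)" by (auto simp: tpow_def)
    define u0 w0 where "u0 = take m t" and "w0 = drop m t"
    have t_eq: "t = u0 @ w0" and u0: "u0 \<in> words A m" "length u0 = m" and w0: "length w0 = n"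
      using \<open>t \<in> words A (m + n)\<close>
      by (auto simp: u0_def w0_def words_def dest: in_set_takeD)
    \<comment> \<open>The pivot is the entry of row u0 and column w0.\<close>
    define c where "c = inverse (z t)"
    define x where "x = (\<lambda>u. z (u @ w0))"
    define y where "y = (\<lambda>w. c * z (u0 @ w))"
    have x: "x \<in> V" using less.prems(2)[OF w0] by (simp add: x_def)
    have y: "y \<in> W"
      using linear_set_scale[OF W less.prems(3)[OF u0(2)]] by (simp add: y_def)
    define z' where "z' = (\<lambda>u. - 1 * (x \<otimes> y) u + z u)"
    have x_tpow: "x \<in> tpow A m"
      using slice_in_tpow[of z "[]" m w0] less.prems(1) w0 by (simp add: x_def)
    have prod: "(x \<otimes> y) u = x (take m u) * y (drop m u)" for u
      using ttimes_homogeneous[OF x_tpow] by simp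
    have z': "z' (u @ w) = z (u @ w) - z (u @ w0) * (c * z (u0 @ w))" if "length u = m" for u w
      using that by (simp add: z'_def prod) (simp add: x_def y_def)
    have z'_tpow: "z' \<in> tpow A (m + n)"
    proof -
      have "(\<lambda>w. z (u0 @ w)) \<in> tpow A n"
        using slice_in_tpow[of z u0 n "[]"] less.prems(1) u0(2) by simp
      then have "y \<in> tpow A n"
        unfolding y_def by (rule linear_set_scale[OF linear_set_tpow])
      then show ?thesis
        unfolding z'_def using less.prems(1) x_tpow
        by (intro linear_set_add[OF linear_set_tpow] ttimes_in_tpow)
    qed
    have "z' \<in> V \<otimes>\<^sub>s W"
    proof (rule less.hyps)
      have "u0 \<in> ?rows z" using t t_eq u0 by auto
      moreover have "u0 \<notin> ?rows z'" using t t_eq u0 by (auto simp: z' c_def)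
      moreover have "?rows z' \<subseteq> ?rows z"
      proof
        fix u
        assume u: "u \<in> ?rows z'"
        then obtain w where w: "z' (u @ w) \<noteq> 0" by blast
        have "length u = m" using u by (simp add: words_def)
        with w have "z (u @ w) \<noteq> 0 \<or> z (u @ w0) \<noteq> 0" by (auto simp: z')
        with u show "u \<in> ?rows z" by blast
      qed
      ultimately have "?rows z' \<subset> ?rows z" by blast
      then show "card (?rows z') < card (?rows z)"
        by (intro psubset_card_mono) (simp_all add: finite_words)
    next
      show "z' \<in> tpow A (m + n)" by (rule z'_tpow)
    next
      fix w :: "'a list"
      assume w: "length w = n"
      have eq: "(\<lambda>u. z' (u @ w)) = (\<lambda>u. - (c * z (u0 @ w)) * z (u @ w0) + z (u @ w))"
      proof
        fix u
        show "z' (u @ w) = - (c * z (u0 @ w)) * z (u @ w0) + z (u @ w)"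
        proof (cases "length u = m")
          case True
          then show ?thesis by (simp add: z')
        next
          case False
          then have "z (u @ w) = 0" "z (u @ w0) = 0" "z' (u @ w) = 0"
            using w w0 less.prems(1) z'_tpow by (auto simp: tpow_def words_def)
          then show ?thesis by simp
        qed
      qed
      show "(\<lambda>u. z' (u @ w)) \<in> V"
        unfolding eq by (rule linear_set_add[OF V less.prems(2)[OF w0] less.prems(2)[OF w]])
    next
      fix u :: "'a list"
      assume u: "length u = m"
      then have eq: "(\<lambda>w. z' (u @ w)) = (\<lambda>w. - (z (u @ w0) * c) * z (u0 @ w) + z (u @ w))"
        by (simp add: z' mult.assoc)
      show "(\<lambda>w. z' (u @ w)) \<in> W"
        unfolding eq by (rule linear_set_add[OF W less.prems(3)[OF u0(2)] less.prems(3)[OF u]])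
    qed
    then have "(\<lambda>u. 1 * (x \<otimes> y) u + z' u) \<in> V \<otimes>\<^sub>s W"
      by (intro linear_set_add linear_set_subspace_tensor V elementary_in_subspace_tensor x y)
    then show ?thesis by (simp add: z'_def)
  qed
qed

text \<open>
  Multiplication by an element supported on the places i, ..., i + m - 1 acts on each slice of z
  along these places separately.
\<close>

lemma slice_tmult:
  assumes u: "length u = i" and w: "length w = j" and v: "length v = m"
    and x: "x \<in> tpow A m" and z: "z \<in> tpow A (i + m + j)"
  shows "(emb (i + m + j) [i..<i + m] x \<odot> z) (u @ v @ w) = (x \<odot> (\<lambda>v. z (u @ v @ w))) v"
    and "(z \<odot> emb (i + m + j) [i..<i + m] x) (u @ v @ w) = ((\<lambda>v. z (u @ v @ w)) \<odot> x) v"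
proof -
  let ?N = "i + m + j"
  have pos: "positions ?N [i..<i + m]" by (simp add: positions_upt)
  have "(emb ?N [i..<i + m] x \<odot> z) (u @ v @ w) = (x \<odot> (\<lambda>v. z (u @ v @ w))) v \<and>
    (z \<odot> emb ?N [i..<i + m] x) (u @ v @ w) = ((\<lambda>v. z (u @ v @ w)) \<odot> x) v"
    using x
  proof (induction rule: tpow_induct)
    case (pure xs)
    then obtain g where g: "xs = map g [i..<i + m]" "\<And>l. l \<notin> set [i..<i + m] \<Longrightarrow> g l = 1"
      using positions_values[OF pos, of xs] by auto
    have "map g [0..<?N] = replicate i 1 @ xs @ replicate j 1"
      using g(2) by (intro nth_equalityI) (auto simp: g(1) nth_append)
    then have emb: "emb ?N [i..<i + m] (pure_tensor A xs) =
        pure_tensor A (replicate i 1 @ xs @ replicate j 1)"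
      using emb_pure_tensor[OF pos, of g] g by simp
    show ?case
      using z
    proof (induction rule: tpow_induct)
      case (pure zs)
      \<comment> \<open>A slice of a pure tensor is a multiple of its middle part.\<close>
      define z1 z2 z3 where "z1 = take i zs" and "z2 = take m (drop i zs)" and "z3 = drop (i + m) zs"
      have zs: "zs = z1 @ z2 @ z3"
        by (simp add: z1_def z2_def z3_def append_assoc[symmetric] take_add[symmetric] del: append_assoc)
      have len: "length z1 = i" "length z2 = m" "length z3 = j"
        using pure by (simp_all add: z1_def z2_def z3_def)
      have one: "map2 (*) (replicate (length ys) 1) ys = ys" "map2 (*) ys (replicate (length ys) 1) = ys"
        for ys :: "'a list"
        by (intro nth_equalityI; simp)+
      have slice: "(\<lambda>v. pure_tensor A zs (u @ v @ w)) =
          (\<lambda>v. (pure_tensor A z1 u * pure_tensor A z3 w) * pure_tensor A z2 v)"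
      proof
        fix v
        show "pure_tensor A zs (u @ v @ w) =
          (pure_tensor A z1 u * pure_tensor A z3 w) * pure_tensor A z2 v"
          using u w len
          by (cases "length v = m") (simp_all add: zs pure_tensor_append pure_tensor_length)
      qed
      show ?case
        unfolding emb slice
        using u v w len \<open>length xs = m\<close> one[of z1] one[of z3]
        by (simp add: tmult_scale tmult_pure_tensor zs pure_tensor_append)
    qed (simp_all add: tmult_linear)
  qed (simp_all add: tmult_linear emb_linear)
  then show "(emb ?N [i..<i + m] x \<odot> z) (u @ v @ w) = (x \<odot> (\<lambda>v. z (u @ v @ w))) v"
    and "(z \<odot> emb ?N [i..<i + m] x) (u @ v @ w) = ((\<lambda>v. z (u @ v @ w)) \<odot> x) v"
    by blast+
qed

lemma flip_in_tpow: "x \<in> tpow A 2 \<Longrightarrow> flip x \<in> tpow A 2"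
  by (simp add: tpow_def flip_def words_def)

lemma flip_subspace_iff:
  assumes "tinvertible A 2 R" "z \<in> tpow A 2"
  shows "z \<in> flip_subspace A R \<longleftrightarrow> R \<odot> z = flip z \<odot> R"
proof -
  note R = tinv_works[OF assms(1)] tinvertible_in_tpow[OF assms(1)]
  have "R \<odot> z \<odot> tinv A 2 R = flip z \<longleftrightarrow> R \<odot> z = flip z \<odot> R"
  proof
    assume "R \<odot> z \<odot> tinv A 2 R = flip z"
    then have "flip z \<odot> R = R \<odot> z \<odot> (tinv A 2 R \<odot> R)" by (simp add: tmult_assoc flip: \<open>_ = flip z\<close>)
    then show "R \<odot> z = flip z \<odot> R" using R assms(2) by (simp add: tmult_tone_right tmult_in_tpow)
  next
    assume "R \<odot> z = flip z \<odot> R"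
    then show "R \<odot> z \<odot> tinv A 2 R = flip z"
      using R assms(2) by (simp add: tmult_assoc tmult_tone_right flip_in_tpow)
  qed
  then show ?thesis using assms(2) by (simp add: flip_subspace_def)
qed

lemma linear_set_flip_subspace: "linear_set (flip_subspace A R)"
  unfolding linear_set_def flip_subspace_def
  by (auto simp: tmult_linear flip_def linear_set_zero linear_set_add linear_set_tpow)

text \<open>
  Evaluated at \<open>u @ v @ w\<close>, both sides of the exchange relation become products in the tensor
  square, by \<open>slice_tmult\<close>; what remains is the defining relation of S, multiplied by R.
\<close>

lemma exch_slice:
  assumes R: "tinvertible A 2 R" and z: "exch R (i + 2 + j) i z"
    and u: "length u = i" and w: "length w = j"
  shows "(\<lambda>v. z (u @ v @ w)) \<in> flip_subspace A R"
proof -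
  let ?N = "i + 2 + j" and ?s = "\<lambda>v. z (u @ v @ w)"
  note Rm = tinvertible_in_tpow[OF R]
  have zN: "z \<in> tpow A ?N" using z by (rule exch_in_tpow)
  have s: "?s \<in> tpow A 2" using zN u w by (intro slice_in_tpow) simp
  have swap_slice: "(\<lambda>v. swap ?N i z (u @ v @ w)) = flip ?s"
  proof
    fix v :: "'a list"
    show "swap ?N i z (u @ v @ w) = flip ?s v"
    proof (cases "length v = 2")
      case True
      then obtain c d where v: "v = [c, d]"
        by (auto simp: length_Suc_conv numeral_2_eq_2)
      have letters: "map (nth (u @ v @ w)) (map (swap_adj i) [0..<?N]) = u @ rev v @ w"
      proof (rule nth_equalityI)
        fix l
        assume "l < length (map (nth (u @ v @ w)) (map (swap_adj i) [0..<?N]))"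
        then show "map (nth (u @ v @ w)) (map (swap_adj i) [0..<?N]) ! l = (u @ rev v @ w) ! l"
          using u w v by (cases "l < i"; cases "l = i"; cases "l = Suc i")
            (auto simp: nth_append nth_Cons' swap_adj_def numeral_2_eq_2 simp del: upt_Suc)
      qed (use u w v in simp)
      have rest: "{..<?N} - set (map (swap_adj i) [0..<?N]) = {}"
      proof -
        have "l \<in> swap_adj i ` {0..<?N}" if "l < ?N" for l
          using that swap_adj_less[of i ?N l] by (intro image_eqI[of _ _ "swap_adj i l"])
            (simp_all add: swap_adj_swap_adj)
        then show ?thesis by (auto simp del: upt_Suc)
      qed
      show ?thesis
        unfolding emb_def letters rest using u w v by (simp add: flip_def)
    next
      case False
      then have "u @ rev v @ w \<notin> words A ?N" using u w by (simp add: words_def)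
      then have "z (u @ rev v @ w) = 0" using zN by (simp add: tpow_def)
      then show ?thesis using False u w by (simp add: emb_def flip_def)
    qed
  qed
  have upt: "[i, Suc i] = [i..<i + 2]" by (simp add: numeral_2_eq_2 upt_conv_Cons)
  have "R \<odot> ?s = flip ?s \<odot> R"
  proof
    fix v
    show "(R \<odot> ?s) v = (flip ?s \<odot> R) v"
    proof (cases "length v = 2")
      case True
      have "swap ?N i z \<in> tpow A ?N" using zN by (intro swap_in_tpow) simp_all
      then show ?thesis
        using slice_tmult[OF u w True Rm] zN z unfolding exch_def upt
        by (metis swap_slice)
    next
      case False
      then show ?thesis
        using tmult_in_tpow[OF Rm s] tmult_in_tpow[OF flip_in_tpow[OF s] Rm]
        by (simp add: tpow_def words_def)
    qed
  qed
  then show ?thesis using flip_subspace_iff[OF R s] by simp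
qed

lemma linear_set_sub_component: "linear_set (sub_component A R n)"
  unfolding sub_component_def
  by (auto intro!: linear_set_tpow linear_set_Inter linear_set_subspace_tensor)

lemma in_sub_componentI:
  assumes R: "tinvertible A 2 R" and z: "z \<in> tpow A n"
    and slice: "\<And>i j u w. i + j + 2 = n \<Longrightarrow> length u = i \<Longrightarrow> length w = j \<Longrightarrow>
      (\<lambda>v. z (u @ v @ w)) \<in> flip_subspace A R"
  shows "z \<in> sub_component A R n"
proof (cases "n < 2")
  case True
  with z show ?thesis by (simp add: sub_component_def)
next
  case False
  have "z \<in> tpow A i \<otimes>\<^sub>s flip_subspace A R \<otimes>\<^sub>s tpow A j" if ij: "i + j + 2 = n" for i j
  proof (rule in_subspace_tensorI[where m = i and n = "2 + j"])
    show z': "z \<in> tpow A (i + (2 + j))" using z ij by (simp add: ac_simps)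
    show "(\<lambda>u. z (u @ w)) \<in> tpow A i" if "length w = 2 + j" for w
      using slice_in_tpow[of z "[]" i w] z' that by simp
    show "(\<lambda>w. z (u @ w)) \<in> flip_subspace A R \<otimes>\<^sub>s tpow A j" if u: "length u = i" for u
    proof (rule in_subspace_tensorI[where m = 2 and n = j])
      show "(\<lambda>w. z (u @ w)) \<in> tpow A (2 + j)"
        using slice_in_tpow[of z u "2 + j" "[]"] z' u by (simp add: add.assoc)
      then show "(\<lambda>w. z (u @ v @ w)) \<in> tpow A j" if "length v = 2" for v
        using slice_in_tpow[of "\<lambda>w. z (u @ w)" v j "[]"] that by simp
      show "(\<lambda>v. z (u @ v @ w)) \<in> flip_subspace A R" if "length w = j" for w
        using slice[OF ij u that] .
    qed (simp_all add: linear_set_flip_subspace linear_set_tpow)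
  qed (simp_all add: linear_set_subspace_tensor linear_set_flip_subspace linear_set_tpow)
  with False show ?thesis by (auto simp: sub_component_def)
qed

text \<open>
  The columns of z are its slices along the first m places; their slices in turn are slices of
  z itself, to which \<open>exch_slice\<close> applies.
\<close>

lemma in_sub_component_tensorI:
  assumes R: "tinvertible A 2 R" and z: "z \<in> tpow A (m + n)"
    and exch: "\<And>a. Suc a < m + n \<Longrightarrow> Suc a \<noteq> m \<Longrightarrow> exch R (m + n) a z"
  shows "z \<in> sub_component A R m \<otimes>\<^sub>s sub_component A R n"
proof (rule in_subspace_tensorI[where m = m and n = n])
  fix w :: "'a list"
  assume w: "length w = n"
  show "(\<lambda>u. z (u @ w)) \<in> sub_component A R m"
  proof (rule in_sub_componentI[OF R])
    show "(\<lambda>u. z (u @ w)) \<in> tpow A m"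
      using slice_in_tpow[of z "[]" m w] z w by simp
    show "(\<lambda>v. z ((u @ v @ w') @ w)) \<in> flip_subspace A R"
      if "i + j + 2 = m" "length u = i" "length w' = j" for i j u w'
    proof -
      have N: "i + 2 + (j + n) = m + n" using that by simp
      show ?thesis
        using exch_slice[OF R, of i "j + n" z u "w' @ w", unfolded N] exch[of i] that w by simp
    qed
  qed
next
  fix u :: "'a list"
  assume u: "length u = m"
  show "(\<lambda>w. z (u @ w)) \<in> sub_component A R n"
  proof (rule in_sub_componentI[OF R])
    show "(\<lambda>w. z (u @ w)) \<in> tpow A n"
      using slice_in_tpow[of z u n "[]"] z u by simp
    show "(\<lambda>v. z (u @ u' @ v @ w)) \<in> flip_subspace A R"
      if "i + j + 2 = n" "length u' = i" "length w = j" for i j u' w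
    proof -
      have N: "m + i + 2 + j = m + n" using that by simp
      show ?thesis
        using exch_slice[OF R, of "m + i" j z "u @ u'" w, unfolded N] exch[of "m + i"] that u by simp
    qed
  qed
qed (use z in \<open>simp_all add: linear_set_sub_component\<close>)

end

theorem mainTheorem2:
  fixes A :: "('k::field, 'a::{ring,monoid_mult}) based_algebra" (structure)
    and R P Rt :: "('k, 'a) tensor"
    and F :: "nat \<Rightarrow> ('k, 'a) tensor"
  assumes "fd_algebra A"
    and "tinvertible A 2 R"
    and "place A 3 1 2 R \<odot> place A 3 1 3 R \<odot> place A 3 2 3 R
       = place A 3 2 3 R \<odot> place A 3 1 3 R \<odot> place A 3 1 2 R"
    and "tinvertible A 2 P"
    and "Rt = tinv A 2 (place A 2 2 1 P) \<odot> R \<odot> place A 2 1 2 P"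
    and "place A 3 2 3 R \<odot> place A 3 1 2 P \<odot> place A 3 1 3 P
       = place A 3 1 3 P \<odot> place A 3 1 2 P \<odot> place A 3 2 3 R"
    and "place A 3 1 2 Rt \<odot> place A 3 1 3 P \<odot> place A 3 2 3 P
       = place A 3 2 3 P \<odot> place A 3 1 3 P \<odot> place A 3 1 2 Rt"
    and "\<And>k. F k = foldl (\<odot>) (tone A (k + 1)) (map (\<lambda>j. place A (k + 1) 1 j P) [2..<k + 2])"
  shows "(\<exists>!\<Phi>. twist_with_components A F \<Phi>) \<and>
    (\<forall>\<Phi>. twist_with_components A F \<Phi> \<longrightarrow> \<Phi> \<in> sub_square A R)"
proof -
  interpret fd_algebra A by fact
  note R = \<open>tinvertible A 2 R\<close> and P = \<open>tinvertible A 2 P\<close>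
  have F: "F k = foldl (\<odot>) (tone A (Suc k)) (map (\<lambda>j. emb (Suc k) [0, j] P) [1..<Suc k])" for k
  proof -
    have "map (\<lambda>j. place A (k + 1) 1 j P) [2..<k + 2] = map (\<lambda>j. emb (Suc k) [0, j] P) [1..<Suc k]"
      by (intro nth_equalityI) (simp_all add: place_eq_emb del: upt_Suc)
    then show ?thesis using assms(8)[of k] by simp
  qed
  have F_inv: "tinvertible A (Suc k) (F k)" for k
  proof -
    have "tinvertible A (Suc k) (foldl (\<odot>) x (map (\<lambda>j. emb (Suc k) [0, j] P) js))"
      if "set js \<subseteq> {1..k}" "tinvertible A (Suc k) x" for js x
      using that
    proof (induction js arbitrary: x)
      case (Cons j js)
      have "tinvertible A (Suc k) (emb (Suc k) [0, j] P)"
        using P by (rule tinvertible_emb) (use Cons.prems in \<open>auto simp: positions_def\<close>)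
      then show ?case using Cons by (simp add: tinvertible_tmult)
    qed simp
    from this[of "[1..<Suc k]"] show ?thesis
      unfolding F by (simp add: tinvertible_tone atLeastLessThanSuc_atLeastAtMost del: upt_Suc)
  qed
  have P_id: "emb 2 [0, 1] P = P"
    using emb_id[OF tinvertible_in_tpow[OF P]] by (simp add: numeral_2_eq_2)
  have comp: "exch R (m + n) a (\<Phi> m n)"
    if "twist_with_components A F \<Phi>" "Suc a < m + n" "Suc a \<noteq> m" for \<Phi> m n a
    using exch_twist_component[OF R P _ _ _ F that] assms(5-7)
    by (simp add: place_eq_emb P_id[simplified])
  have "\<Phi> \<in> sub_square A R" if \<Phi>: "twist_with_components A F \<Phi>" for \<Phi>
  proof -
    have "\<Phi> m n \<in> tpow A (m + n)" for m n
      using \<Phi> by (simp add: twist_with_components_def T2_invertible_iff tinvertible_in_tpow)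
    then show ?thesis
      using comp[OF \<Phi>] R by (auto simp: sub_square_def intro!: in_sub_component_tensorI)
  qed
  moreover have "\<exists>!\<Phi>. twist_with_components A F \<Phi>"
    using F_inv by (rule ex1_twist_with_components) (simp add: F)
  ultimately show ?thesis by blast
qed

end
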